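(* Let $V\neq\{0\}$ be a Banach $\mathbb O$-bimodule and $T\in\mathscr B_{\mathcal{RO}}(V)$ power-associative. Then every $s\in\mathbb O$ with $|s|>\|T\|$ belongs to $\rho_*(T)$ (indeed to ${\rho_*}_J(T)$ for any $J$ with $s\in\mathbb C_J$), and for every $J\in\mathbb S$ the set ${\sigma_*}_J(T):=\mathbb C_J\setminus{\rho_*}_J(T)$ is a nonempty compact subset of $\mathbb C_J$.
   Context: $\mathbb O$ is the real octonion algebra with basis $e_0=1,\dots,e_7$, norm $|x|$; $\mathbb S=\{J\in\mathbb O:J^2=-1\}$, $\mathbb C_J=\mathbb R+\mathbb RJ$. An $\mathbb O$-bimodule is a real vector space $M$ with real-bilinear left and right multiplications by $\mathbb O$ (with $1x=x1=x$) whose associators $[p,q,x]=(pq)x-p(qx)$, $[p,x,q]=(px)q-p(xq)$, $[x,p,q]=(xp)q-x(pq)$ satisfy $[p,q,x]=[q,x,p]=[x,p,q]=-[q,p,x]$. Its real part is $\operatorname{Re}M=\{m: pm=mp,\ [p,q,m]=0\ \forall p,q\}$; $\operatorname{Re}x$ is the $e_0$-component in the unique decomposition $x=\sum e_ix_i$, $x_i\in\operatorname{Re}M$. A Banach $\mathbb O$-bimodule is one with a complete norm with $\|px\|=\|xp\|=|p|\|x\|$. $\mathscr B_{\mathbb R}(V)$: bounded real-linear operators; invertible means in $\mathscr B_{\mathbb R}(V)$; $R_sv=vs$. $\mathscr B_{\mathcal{RO}}(V)$: bounded real-linear $f$ with $\operatorname{Re}(f(x)p-f(xp))=0$ for all $p,x$.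 $T$ is power-associative if $T^n\in\mathscr B_{\mathcal{RO}}(V)$ for all $n$. $S$ is $\mathbb C_J$-liftable power associative if $\operatorname{Re}(S^n(v\lambda))=\operatorname{Re}(S^n(v)\lambda)$ for all $n\ge1,v\in V,\lambda\in\mathbb C_J$. ${\rho_*}_J(T)=\{s\in\mathbb C_J: R_s-T$ invertible and $(R_s-T)^{-1}$ $\mathbb C_J$-liftable power associative$\}$, $\rho_*(T)=\bigcup_J{\rho_*}_J(T)$, push-forward spectrum $\sigma_*(T)=\mathbb O\setminus\rho_*(T)$. *)

theory Defs
  imports "HOL-Analysis.Analysis"
begin

section \<open>The real octonion algebra O, realised on real^8 (Euclidean norm = octonion norm)\<close>

type_synonym oct = "real ^ 8"

text \<open>Fano-plane triples (i,j,k) with e_i e_j = e_k (standard convention).\<close>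
definition oct_triples :: "(8 \<times> 8 \<times> 8) set" where
  "oct_triples = {(1,2,3),(1,4,5),(1,7,6),(2,4,6),(2,5,7),(3,4,7),(3,6,5)}"

definition oct_cyc :: "(8 \<times> 8 \<times> 8) set" where
  "oct_cyc = {(a,b,c) | a b c. (a,b,c) \<in> oct_triples \<or> (b,c,a) \<in> oct_triples \<or> (c,a,b) \<in> oct_triples}"

definition oct_c :: "8 \<Rightarrow> 8 \<Rightarrow> 8 \<Rightarrow> real" where
  "oct_c i j k =
     (if i = 0 then (if j = k then 1 else 0)
      else if j = 0 then (if i = k then 1 else 0)
      else if i = j then (if k = 0 then -1 else 0)
      else if (i,j,k) \<in> oct_cyc then 1
      else if (j,i,k) \<in> oct_cyc then -1
      else 0)"

definition omult :: "oct \<Rightarrow> oct \<Rightarrow> oct" (infixl "\<cdot>\<^sub>O" 70) where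
  "omult x y = (\<chi> k. \<Sum>i\<in>UNIV. \<Sum>j\<in>UNIV. x$i * y$j * oct_c i j k)"

definition oe :: "8 \<Rightarrow> oct" where "oe i = axis i 1"

definition oone :: oct where "oone = oe 0"

definition oct_S :: "oct set" where "oct_S = {J. J \<cdot>\<^sub>O J = - oone}"

definition CJ :: "oct \<Rightarrow> oct set" where
  "CJ J = {scaleR a oone + scaleR b J | a b. True}"

text \<open>lm p x = p x (left action), rm x p = x p (right action).\<close>

definition assoc_pqx where "assoc_pqx lm p q x = lm (p \<cdot>\<^sub>O q) x - lm p (lm q x)"
definition assoc_pxq where "assoc_pxq lm rm p x q = rm (lm p x) q - lm p (rm x q)"
definition assoc_xpq where "assoc_xpq rm x p q = rm (rm x p) q - rm x (p \<cdot>\<^sub>O q)"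

definition O_bimodule :: "(oct \<Rightarrow> 'v::real_vector \<Rightarrow> 'v) \<Rightarrow> ('v \<Rightarrow> oct \<Rightarrow> 'v) \<Rightarrow> bool" where
  "O_bimodule lm rm \<longleftrightarrow>
     bilinear lm \<and> bilinear rm \<and>
     (\<forall>x. lm oone x = x) \<and> (\<forall>x. rm x oone = x) \<and>
     (\<forall>p q x. assoc_pqx lm p q x = assoc_pxq lm rm q x p
            \<and> assoc_pxq lm rm q x p = assoc_xpq rm x p q
            \<and> assoc_xpq rm x p q = - assoc_pqx lm q p x)"

definition Banach_O_bimodule :: "(oct \<Rightarrow> 'v::banach \<Rightarrow> 'v) \<Rightarrow> ('v \<Rightarrow> oct \<Rightarrow> 'v) \<Rightarrow> bool" where
  "Banach_O_bimodule lm rm \<longleftrightarrow> O_bimodule lm rm \<and>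
     (\<forall>p x. norm (lm p x) = norm p * norm x \<and> norm (rm x p) = norm p * norm x)"

definition ReM :: "(oct \<Rightarrow> 'v::real_vector \<Rightarrow> 'v) \<Rightarrow> ('v \<Rightarrow> oct \<Rightarrow> 'v) \<Rightarrow> 'v set" where
  "ReM lm rm = {m. (\<forall>p. lm p m = rm m p) \<and> (\<forall>p q. assoc_pqx lm p q m = 0)}"

text \<open>Re x: the e_0-component of the unique decomposition x = sum_i e_i x_i, x_i in Re M.\<close>
definition ReV :: "(oct \<Rightarrow> 'v::real_vector \<Rightarrow> 'v) \<Rightarrow> ('v \<Rightarrow> oct \<Rightarrow> 'v) \<Rightarrow> 'v \<Rightarrow> 'v" where
  "ReV lm rm x = (THE x0. \<exists>xs. (\<forall>i. xs i \<in> ReM lm rm) \<and>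
                         x = (\<Sum>i\<in>UNIV. lm (oe i) (xs i)) \<and> x0 = xs 0)"

definition B_invertible :: "('v::real_normed_vector \<Rightarrow> 'v) \<Rightarrow> bool" where
  "B_invertible f \<longleftrightarrow> bounded_linear f \<and>
     (\<exists>g. bounded_linear g \<and> g \<circ> f = id \<and> f \<circ> g = id)"

definition B_RO :: "(oct \<Rightarrow> 'v::real_normed_vector \<Rightarrow> 'v) \<Rightarrow> ('v \<Rightarrow> oct \<Rightarrow> 'v) \<Rightarrow> ('v \<Rightarrow> 'v) set" where
  "B_RO lm rm = {f. bounded_linear f \<and> (\<forall>p x. ReV lm rm (rm (f x) p - f (rm x p)) = 0)}"

definition power_associative where
  "power_associative lm rm T \<longleftrightarrow> (\<forall>n. (T ^^ n) \<in> B_RO lm rm)"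

definition CJ_liftable_power_assoc where
  "CJ_liftable_power_assoc lm rm J S \<longleftrightarrow>
     (\<forall>n\<ge>1. \<forall>v. \<forall>c\<in>CJ J. ReV lm rm ((S ^^ n) (rm v c)) = ReV lm rm (rm ((S ^^ n) v) c))"

definition rho_J :: "(oct \<Rightarrow> 'v::real_normed_vector \<Rightarrow> 'v) \<Rightarrow> ('v \<Rightarrow> oct \<Rightarrow> 'v) \<Rightarrow> oct \<Rightarrow> ('v \<Rightarrow> 'v) \<Rightarrow> oct set" where
  "rho_J lm rm J T = {s \<in> CJ J. B_invertible (\<lambda>v. rm v s - T v) \<and>
        CJ_liftable_power_assoc lm rm J (inv (\<lambda>v. rm v s - T v))}"

definition rho_star where
  "rho_star lm rm T = (\<Union>J\<in>oct_S. rho_J lm rm J T)"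

definition sigma_star where
  "sigma_star lm rm T = UNIV - rho_star lm rm T"

definition sigma_J where
  "sigma_J lm rm J T = CJ J - rho_J lm rm J T"

end

theory Submission
  imports Defs
begin

text \<open>Fix J in S and view V as a complex Banach space through j = right multiplication by J.
  The algebraic input is that the real part Re : V -> V is a bounded linear map, nonzero as soon
  as V is nonzero. An operator S is liftable iff Re vanishes on every vector S^n (j x) - j (S^n x);
  equivalently, there is a closed complex subspace K of ker Re that is invariant under S and such
  that S induces a complex-linear operator on V/K. This property passes to the Neumann series
  around a point of the resolvent set and around infinity, which gives openness of the resolvent
  set and the bound by the norm of T. If the resolvent set were all of C_J, the mean of
  Re ((R_s - T)^{-1} x) over the circle of radius r around 0 would be independent of r (as for
  holomorphic functions) and tend to 0 as r grows, so its value Re (-T^{-1} x) at r = 0 would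
  vanish for all x, forcing Re = 0.\<close>

section \<open>Octonion arithmetic\<close>

lemma UNIV_8: "(UNIV :: 8 set) = {0,1,2,3,4,5,6,7}"
  by (rule sym, rule card_subset_eq) auto

lemma forall_8: "(\<forall>i::8. P i) \<longleftrightarrow> P 0 \<and> P 1 \<and> P 2 \<and> P 3 \<and> P 4 \<and> P 5 \<and> P 6 \<and> P 7"
proof -
  have "(\<forall>i::8. P i) \<longleftrightarrow> (\<forall>i\<in>{0,1,2,3,4,5,6,7::8}. P i)"
    using UNIV_8 by blast
  then show ?thesis by simp
qed

lemma sum_8: "(\<Sum>i\<in>(UNIV::8 set). f i) = f 0 + f 1 + f 2 + f 3 + f 4 + f 5 + f 6 + (f 7 :: 'a::comm_monoid_add)"
  unfolding UNIV_8 by (simp add: add.assoc)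

lemma oct_expand: "x = (\<Sum>i\<in>UNIV. scaleR (x $ i) (oe i))" for x :: oct
  by (simp add: vec_eq_iff oe_def axis_def if_distrib cong: if_cong)

lemma bilinear_omult: "bilinear omult"
  unfolding bilinear_def linear_iff omult_def
  by (simp add: vec_eq_iff algebra_simps sum.distrib sum_distrib_left)

lemma omult_oe: "oe i \<cdot>\<^sub>O oe j = (\<chi> k. oct_c i j k)"
proof -
  have "(\<Sum>i'\<in>UNIV. \<Sum>j'\<in>UNIV. oe i $ i' * oe j $ j' * oct_c i' j' k) = oct_c i j k" for k
  proof -
    have "(\<Sum>i'\<in>UNIV. \<Sum>j'\<in>UNIV. oe i $ i' * oe j $ j' * oct_c i' j' k)
        = (\<Sum>i'\<in>UNIV. \<Sum>j'\<in>UNIV. if j' = j then (if i' = i then oct_c i' j' k else 0) else 0)"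
      by (intro sum.cong refl) (simp add: oe_def axis_def)
    then show ?thesis by simp
  qed
  then show ?thesis by (simp add: omult_def)
qed

lemma oct_cyc_expand: "(a,b,c) \<in> oct_cyc \<longleftrightarrow>
    (a,b,c) \<in> oct_triples \<or> (b,c,a) \<in> oct_triples \<or> (c,a,b) \<in> oct_triples"
  by (auto simp: oct_cyc_def)

lemma omult_table:
  "oe 1 \<cdot>\<^sub>O oe 1 = - oone" "oe 1 \<cdot>\<^sub>O oe 2 = oe 3" "oe 1 \<cdot>\<^sub>O oe 3 = - oe 2" "oe 1 \<cdot>\<^sub>O oe 4 = oe 5" "oe 1 \<cdot>\<^sub>O oe 5 = - oe 4" "oe 1 \<cdot>\<^sub>O oe 6 = - oe 7" "oe 1 \<cdot>\<^sub>O oe 7 = oe 6"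
  "oe 2 \<cdot>\<^sub>O oe 1 = - oe 3" "oe 2 \<cdot>\<^sub>O oe 2 = - oone" "oe 2 \<cdot>\<^sub>O oe 3 = oe 1" "oe 2 \<cdot>\<^sub>O oe 4 = oe 6" "oe 2 \<cdot>\<^sub>O oe 5 = oe 7" "oe 2 \<cdot>\<^sub>O oe 6 = - oe 4" "oe 2 \<cdot>\<^sub>O oe 7 = - oe 5"
  "oe 3 \<cdot>\<^sub>O oe 1 = oe 2" "oe 3 \<cdot>\<^sub>O oe 2 = - oe 1" "oe 3 \<cdot>\<^sub>O oe 3 = - oone" "oe 3 \<cdot>\<^sub>O oe 4 = oe 7" "oe 3 \<cdot>\<^sub>O oe 5 = - oe 6" "oe 3 \<cdot>\<^sub>O oe 6 = oe 5" "oe 3 \<cdot>\<^sub>O oe 7 = - oe 4"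
  "oe 4 \<cdot>\<^sub>O oe 1 = - oe 5" "oe 4 \<cdot>\<^sub>O oe 2 = - oe 6" "oe 4 \<cdot>\<^sub>O oe 3 = - oe 7" "oe 4 \<cdot>\<^sub>O oe 4 = - oone" "oe 4 \<cdot>\<^sub>O oe 5 = oe 1" "oe 4 \<cdot>\<^sub>O oe 6 = oe 2" "oe 4 \<cdot>\<^sub>O oe 7 = oe 3"
  "oe 5 \<cdot>\<^sub>O oe 1 = oe 4" "oe 5 \<cdot>\<^sub>O oe 2 = - oe 7" "oe 5 \<cdot>\<^sub>O oe 3 = oe 6" "oe 5 \<cdot>\<^sub>O oe 4 = - oe 1" "oe 5 \<cdot>\<^sub>O oe 5 = - oone" "oe 5 \<cdot>\<^sub>O oe 6 = - oe 3" "oe 5 \<cdot>\<^sub>O oe 7 = oe 2"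
  "oe 6 \<cdot>\<^sub>O oe 1 = oe 7" "oe 6 \<cdot>\<^sub>O oe 2 = oe 4" "oe 6 \<cdot>\<^sub>O oe 3 = - oe 5" "oe 6 \<cdot>\<^sub>O oe 4 = - oe 2" "oe 6 \<cdot>\<^sub>O oe 5 = oe 3" "oe 6 \<cdot>\<^sub>O oe 6 = - oone" "oe 6 \<cdot>\<^sub>O oe 7 = - oe 1"
  "oe 7 \<cdot>\<^sub>O oe 1 = - oe 6" "oe 7 \<cdot>\<^sub>O oe 2 = oe 5" "oe 7 \<cdot>\<^sub>O oe 3 = oe 4" "oe 7 \<cdot>\<^sub>O oe 4 = - oe 3" "oe 7 \<cdot>\<^sub>O oe 5 = - oe 2" "oe 7 \<cdot>\<^sub>O oe 6 = oe 1" "oe 7 \<cdot>\<^sub>O oe 7 = - oone"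
  unfolding omult_oe
  by (simp_all add: vec_eq_iff forall_8 oct_c_def oct_cyc_expand oct_triples_def oe_def oone_def axis_def)

lemma oe_sq: "i \<noteq> 0 \<Longrightarrow> oe i \<cdot>\<^sub>O oe i = - oone"
proof -
  have "\<forall>i. i \<noteq> 0 \<longrightarrow> oe i \<cdot>\<^sub>O oe i = - oone"
    unfolding forall_8 by (simp add: omult_table)
  then show "i \<noteq> 0 \<Longrightarrow> oe i \<cdot>\<^sub>O oe i = - oone" by blast
qed

lemma oe_anticomm: "i \<noteq> 0 \<Longrightarrow> j \<noteq> 0 \<Longrightarrow> i \<noteq> j \<Longrightarrow> oe i \<cdot>\<^sub>O oe j = - (oe j \<cdot>\<^sub>O oe i)"
proof -
  have "\<forall>i j. i \<noteq> 0 \<longrightarrow> j \<noteq> 0 \<longrightarrow> i \<noteq> j \<longrightarrow> oe i \<cdot>\<^sub>O oe j = - (oe j \<cdot>\<^sub>O oe i)"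
    unfolding forall_8 by (simp add: omult_table)
  then show "i \<noteq> 0 \<Longrightarrow> j \<noteq> 0 \<Longrightarrow> i \<noteq> j \<Longrightarrow> oe i \<cdot>\<^sub>O oe j = - (oe j \<cdot>\<^sub>O oe i)" by blast
qed

lemmas omult_lin =
  bilinear_ladd[OF bilinear_omult] bilinear_radd[OF bilinear_omult]
  bilinear_lmul[OF bilinear_omult] bilinear_rmul[OF bilinear_omult]
  bilinear_lneg[OF bilinear_omult] bilinear_rneg[OF bilinear_omult]
  bilinear_lzero[OF bilinear_omult] bilinear_rzero[OF bilinear_omult]
  bilinear_lsub[OF bilinear_omult] bilinear_rsub[OF bilinear_omult]

lemma oone_mult:
  "oone \<cdot>\<^sub>O x = x" "x \<cdot>\<^sub>O oone = x"
proof -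
  have *: "oe 0 \<cdot>\<^sub>O oe i = oe i \<and> oe i \<cdot>\<^sub>O oe 0 = oe i" for i
    by (simp add: omult_oe) (simp add: oct_c_def oe_def axis_def vec_eq_iff)
  show "oone \<cdot>\<^sub>O x = x"
    by (subst (1 2) oct_expand[of x]) (simp add: sum_8 omult_lin oone_def *)
  show "x \<cdot>\<^sub>O oone = x"
    by (subst (1 2) oct_expand[of x]) (simp add: sum_8 omult_lin oone_def *)
qed

lemma oct_basis_induct:
  assumes "\<And>i. P (oe i)" "\<And>a b. P a \<Longrightarrow> P b \<Longrightarrow> P (a + b)" "\<And>c a. P a \<Longrightarrow> P (scaleR c a)"
  shows "P (x :: oct)"
  by (subst oct_expand[of x]) (simp add: sum_8 assms)

section \<open>Imaginary units and the slices C_J\<close>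

lemma oone_nth: "oone $ i = (if i = 0 then 1 else 0)"
  by (simp add: oone_def oe_def axis_def)

lemma norm_oct_sq: "(norm x)\<^sup>2 = (\<Sum>i\<in>UNIV. (x $ i)\<^sup>2)" for x :: oct
  unfolding power2_norm_eq_inner inner_vec_def by (simp add: power2_eq_square)

text \<open>Distinct imaginary units anticommute, so the mixed products cancel in pairs and only the
  squares of the coordinates remain.\<close>

lemma omult_imaginary_sq:
  fixes v :: oct
  assumes "v $ 0 = 0"
  shows "v \<cdot>\<^sub>O v = - ((norm v)\<^sup>2 *\<^sub>R oone)"
proof -
  have v: "v = v$1 *\<^sub>R oe 1 + v$2 *\<^sub>R oe 2 + v$3 *\<^sub>R oe 3 + v$4 *\<^sub>R oe 4
      + v$5 *\<^sub>R oe 5 + v$6 *\<^sub>R oe 6 + v$7 *\<^sub>R oe 7"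
    using oct_expand[of v] assms by (simp add: sum_8)
  have "v \<cdot>\<^sub>O v = - ((\<Sum>i\<in>UNIV. (v $ i)\<^sup>2) *\<^sub>R oone)"
    by (subst (1 2) v) (simp add: omult_lin omult_table sum_8 assms power2_eq_square algebra_simps)
  then show ?thesis by (simp add: norm_oct_sq)
qed

text \<open>Write J = a + v with v imaginary: the real part of J J is a^2 - |v|^2 and the imaginary
  part is 2 a v. The case v = 0 would make a^2 negative, so a = 0.\<close>

lemma oct_S_imaginary_unit:
  assumes "J \<in> oct_S"
  shows "J $ 0 = 0" "norm J = 1"
proof -
  define a v where "a = J $ 0" and "v = J - a *\<^sub>R oone"
  have v0: "v $ 0 = 0" by (simp add: v_def a_def oone_nth)
  have J: "J = a *\<^sub>R oone + v" by (simp add: v_def)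
  have "- oone = J \<cdot>\<^sub>O J" using assms by (simp add: oct_S_def)
  also have "\<dots> = (a * a - (norm v)\<^sup>2) *\<^sub>R oone + (2 * a) *\<^sub>R v"
    unfolding J using scaleR_left_distrib[of a a v]
    by (simp add: omult_lin oone_mult omult_imaginary_sq[OF v0] scaleR_left_diff_distrib scaleR_right_distrib)
  finally have eq: "- oone = (a * a - (norm v)\<^sup>2) *\<^sub>R oone + (2 * a) *\<^sub>R v" .
  have sq: "a * a - (norm v)\<^sup>2 = -1"
    using arg_cong[OF eq, of "\<lambda>x. x $ 0"] v0 by (simp add: oone_nth)
  then have "(2 * a) *\<^sub>R v = 0" using eq by simp
  moreover have "v \<noteq> 0"
  proof
    assume "v = 0"
    then show False using sq zero_le_square[of a] by (simp del: zero_le_square)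
  qed
  ultimately have a: "a = 0" by simp
  then show "J $ 0 = 0" by (simp add: a_def)
  show "norm J = 1" using sq a J by (simp add: power2_eq_1_iff) (metis norm_ge_zero neg_0_le_iff_le not_one_le_zero)
qed

lemma norm_CJ:
  assumes "J \<in> oct_S"
  shows "norm (a *\<^sub>R oone + b *\<^sub>R J) = sqrt (a\<^sup>2 + b\<^sup>2)"
proof -
  have "oone \<bullet> oone = 1" "oone \<bullet> J = 0" "J \<bullet> oone = 0" "J \<bullet> J = 1"
    using oct_S_imaginary_unit[OF assms]
    by (simp_all add: oone_def oe_def inner_axis inner_axis' dot_square_norm)
  then show ?thesis
    by (simp add: norm_eq_sqrt_inner inner_add power2_eq_square)
qed

lemma oct_in_some_CJ: "\<exists>J\<in>oct_S. s \<in> CJ J"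
proof -
  define v where "v = s - (s $ 0) *\<^sub>R oone"
  \<comment> \<open>A real s lies in every slice, so \<open>oe 1\<close> is an arbitrary choice
    there; otherwise the imaginary part of s is normalised.\<close>
  define J where "J = (if v = 0 then oe 1 else (1 / norm v) *\<^sub>R v)"
  have v0: "v $ 0 = 0" by (simp add: v_def oone_nth)
  have "J \<cdot>\<^sub>O J = - oone"
    by (simp add: J_def omult_table omult_lin omult_imaginary_sq[OF v0] power2_eq_square)
  moreover have "s = (s $ 0) *\<^sub>R oone + norm v *\<^sub>R J"
    by (simp add: J_def v_def)
  ultimately show ?thesis unfolding oct_S_def CJ_def by blast
qed

section \<open>The structure of octonion bimodules\<close>

text \<open>Integer multiples are unfolded into sums so that the simplifier can cancel them against
  the summands of expansions over the basis.\<close>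

lemma scaleR_conv_sum:
  fixes x :: "'a::real_vector"
  shows "5 *\<^sub>R x = x + (x + (x + (x + x)))" "8 *\<^sub>R x = x + (x + (x + (x + (x + (x + (x + x))))))"
proof -
  have 4: "4 *\<^sub>R x = (x + x) + (x + x)"
    using scaleR_left_distrib[of 2 2 x] by (simp add: scaleR_2)
  show "5 *\<^sub>R x = x + (x + (x + (x + x)))"
    using scaleR_left_distrib[of 1 4 x] by (simp add: 4 add.assoc)
  show "8 *\<^sub>R x = x + (x + (x + (x + (x + (x + (x + x))))))"
    using scaleR_left_distrib[of 4 4 x] by (simp add: 4 add.assoc)
qed

section \<open>Associator identities of a bimodule\<close>

locale octonion_bimodule =
  fixes lm :: "oct \<Rightarrow> 'v::real_vector \<Rightarrow> 'v" and rm :: "'v \<Rightarrow> oct \<Rightarrow> 'v"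
  assumes bimodule: "O_bimodule lm rm"
begin

abbreviation L :: "8 \<Rightarrow> 'v \<Rightarrow> 'v" where "L i \<equiv> lm (oe i)"

lemma bilinear_lm: "bilinear lm" and bilinear_rm: "bilinear rm"
  using bimodule by (auto simp: O_bimodule_def)

lemmas lin [simp] =
  bilinear_ladd[OF bilinear_lm] bilinear_radd[OF bilinear_lm]
  bilinear_lmul[OF bilinear_lm] bilinear_rmul[OF bilinear_lm]
  bilinear_lneg[OF bilinear_lm] bilinear_rneg[OF bilinear_lm]
  bilinear_lzero[OF bilinear_lm] bilinear_rzero[OF bilinear_lm]
  bilinear_lsub[OF bilinear_lm] bilinear_rsub[OF bilinear_lm]
  bilinear_ladd[OF bilinear_rm] bilinear_radd[OF bilinear_rm]
  bilinear_lmul[OF bilinear_rm] bilinear_rmul[OF bilinear_rm]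
  bilinear_lneg[OF bilinear_rm] bilinear_rneg[OF bilinear_rm]
  bilinear_lzero[OF bilinear_rm] bilinear_rzero[OF bilinear_rm]
  bilinear_lsub[OF bilinear_rm] bilinear_rsub[OF bilinear_rm]

lemma unit [simp]: "lm oone x = x" "rm x oone = x" "L 0 x = x" "rm x (oe 0) = x"
  using bimodule by (auto simp: O_bimodule_def simp flip: oone_def)

text \<open>This and the next two lemmas solve the bimodule axioms for one product. The correction
  term is always an associator of the left action, so mixed and right products are reduced to left
  ones.\<close>

lemma assoc_middle: "rm (lm q x) p = lm q (rm x p) + lm (p \<cdot>\<^sub>O q) x - lm p (lm q x)"
proof -
  have "assoc_pqx lm p q x = assoc_pxq lm rm q x p"
    using bimodule unfolding O_bimodule_def by blast
  then show ?thesis by (simp add: assoc_pqx_def assoc_pxq_def algebra_simps)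
qed

lemma assoc_right: "rm (rm x p) q = rm x (p \<cdot>\<^sub>O q) + lm (p \<cdot>\<^sub>O q) x - lm p (lm q x)"
proof -
  have "assoc_pqx lm p q x = assoc_pxq lm rm q x p" "assoc_pxq lm rm q x p = assoc_xpq rm x p q"
    using bimodule unfolding O_bimodule_def by blast+
  then show ?thesis by (simp add: assoc_pqx_def assoc_xpq_def algebra_simps)
qed

lemma assoc_skew: "lm p (lm q x) = lm (p \<cdot>\<^sub>O q) x + lm (q \<cdot>\<^sub>O p) x - lm q (lm p x)"
proof -
  have "assoc_pqx lm p q x = assoc_pxq lm rm q x p" "assoc_pxq lm rm q x p = assoc_xpq rm x p q"
    "assoc_xpq rm x p q = - assoc_pqx lm q p x"
    using bimodule unfolding O_bimodule_def by blast+
  then have "assoc_pqx lm p q x = - assoc_pqx lm q p x" by (rule trans[OF trans])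
  then show ?thesis by (simp add: assoc_pqx_def algebra_simps)
qed

lemma lm_alternative: "lm p (lm p x) = lm (p \<cdot>\<^sub>O p) x"
proof -
  have "2 *\<^sub>R lm p (lm p x) = 2 *\<^sub>R lm (p \<cdot>\<^sub>O p) x"
    unfolding scaleR_2 by (subst assoc_skew) simp
  then show ?thesis by simp
qed

lemma rm_alternative: "rm (rm x p) p = rm x (p \<cdot>\<^sub>O p)"
  by (simp add: assoc_right lm_alternative)

lemma rm_skew: "rm (rm x p) q = rm x (p \<cdot>\<^sub>O q) + rm x (q \<cdot>\<^sub>O p) - rm (rm x q) p"
  by (simp add: assoc_right assoc_skew[of p q])

section \<open>Clifford relations, Fano lines and joint eigenspaces\<close>

lemma L_sq [simp]: "i \<noteq> 0 \<Longrightarrow> L i (L i x) = - x"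
  by (simp add: lm_alternative oe_sq)

text \<open>Together with \<open>L_sq\<close> this makes the seven operators \<open>L i\<close> with
  i nonzero Clifford generators; the algebra of the involutions \<open>h\<close> below rests on
  these two relations.\<close>

lemma L_anticomm: "i \<noteq> 0 \<Longrightarrow> j \<noteq> 0 \<Longrightarrow> i \<noteq> j \<Longrightarrow> L i (L j x) = - L j (L i x)"
  by (subst assoc_skew) (simp add: oe_anticomm[of i j])

text \<open>An oriented line of the Fano plane: e_a, e_b, e_c multiply like the quaternion units i,
  j, k.\<close>

definition qline :: "8 \<Rightarrow> 8 \<Rightarrow> 8 \<Rightarrow> bool" where
  "qline a b c \<longleftrightarrow> a \<noteq> 0 \<and> b \<noteq> 0 \<and> c \<noteq> 0 \<and> a \<noteq> b \<and> b \<noteq> c \<and> a \<noteq> c \<and>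
     oe a \<cdot>\<^sub>O oe b = oe c \<and> oe b \<cdot>\<^sub>O oe c = oe a \<and> oe c \<cdot>\<^sub>O oe a = oe b \<and>
     oe b \<cdot>\<^sub>O oe a = - oe c \<and> oe c \<cdot>\<^sub>O oe b = - oe a \<and> oe a \<cdot>\<^sub>O oe c = - oe b"

lemma qline_rotate: "qline a b c \<Longrightarrow> qline b c a"
  by (auto simp: qline_def)

lemma qlines: "qline 1 2 3" "qline 1 4 5" "qline 1 7 6" "qline 2 4 6" "qline 2 5 7" "qline 3 4 7" "qline 3 6 5"
  by (simp_all add: qline_def omult_table)

text \<open>The sign s tells whether the line acts on x like the quaternions or with the opposite
  sign. It survives cyclic rotation because L_b L_a L_b = L_a by the Clifford relations.\<close>

lemma line_rotate:
  assumes "qline a b c" "L a (L b x) = s *\<^sub>R L c x" "s * s = 1"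
  shows "L b (L c x) = s *\<^sub>R L a x"
proof -
  have "L c x = s *\<^sub>R L a (L b x)" using assms by simp
  then have "L b (L c x) = s *\<^sub>R L b (L a (L b x))" by simp
  also have "\<dots> = s *\<^sub>R (- L a (L b (L b x)))"
    using assms(1) by (subst L_anticomm) (auto simp: qline_def)
  also have "\<dots> = s *\<^sub>R L a x" using assms(1) by (simp add: qline_def)
  finally show ?thesis .
qed

lemma neg_rotate: "qline a b c \<Longrightarrow> L a (L b x) = - L c x \<Longrightarrow> L b (L c x) = - L a x"
  using line_rotate[of a b c x "-1"] by simp

lemma pos_rotate: "qline a b c \<Longrightarrow> L a (L b x) = L c x \<Longrightarrow> L b (L c x) = L a x"
  using line_rotate[of a b c x 1] by simp

text \<open>On a line acting with the wrong sign the associators do not vanish, and they tie the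
  right action to the left one. Evaluating ((x e_i) e_j) e_i in two ways determines x e_i.\<close>

lemma neg_rm_first:
  assumes line: "qline i j k" and neg: "L i (L j x) = - L k x"
  shows "rm x (oe i) = - L i x"
proof -
  have nz: "i \<noteq> 0" "j \<noteq> 0" "k \<noteq> 0" "i \<noteq> k" and
    m: "oe i \<cdot>\<^sub>O oe j = oe k" "oe k \<cdot>\<^sub>O oe i = oe j" "oe i \<cdot>\<^sub>O oe k = - oe j" "oe j \<cdot>\<^sub>O oe i = - oe k"
    using line by (auto simp: qline_def)
  have neg2: "L j (L k x) = - L i x" by (rule neg_rotate[OF line neg])
  have neg3: "L k (L i x) = - L j x" by (rule neg_rotate[OF qline_rotate[OF line] neg2])
  have neg4: "L i (L k x) = L j x"
    by (subst L_anticomm) (use nz neg3 in auto)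
  have 1: "rm (rm x (oe i)) (oe j) = rm x (oe k) + 2 *\<^sub>R L k x"
    by (simp add: assoc_right m neg scaleR_2)
  have 2: "rm (rm x (oe k)) (oe i) = rm x (oe j) + 2 *\<^sub>R L j x"
    by (simp add: assoc_right m neg3 scaleR_2)
  have 3: "rm (L k x) (oe i) = L k (rm x (oe i)) - 2 *\<^sub>R L j x"
    by (simp add: assoc_middle m neg4 scaleR_2)
  \<comment> \<open>First evaluation: right multiplications by e_i and e_j anticommute. The second
    one expands the associators through the facts 1, 2 and 3.\<close>
  have "rm (rm (rm x (oe i)) (oe j)) (oe i) = - rm (rm (rm x (oe i)) (oe i)) (oe j)"
    by (subst rm_skew) (simp add: m)
  also have "\<dots> = rm x (oe j)"
    by (simp add: rm_alternative oe_sq nz)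
  finally have "rm x (oe j) = rm x (oe j) + 2 *\<^sub>R L j x + 2 *\<^sub>R (L k (rm x (oe i)) - 2 *\<^sub>R L j x)"
    unfolding 1 by (simp add: 2 3)
  then have "2 *\<^sub>R L k (rm x (oe i)) = 2 *\<^sub>R L j x"
    by (simp add: algebra_simps scaleR_2)
  then have "L k (rm x (oe i)) = L j x" by simp
  then have "L k (L k (rm x (oe i))) = L k (L j x)" by simp
  also have "L k (L j x) = - L j (L k x)"
    using line by (subst L_anticomm) (auto simp: qline_def)
  finally show ?thesis using neg2 nz by (simp add: minus_equation_iff)
qed

text \<open>The associator of e_1, e_2 and e_4 x, computed once from the left action and once from
  the mixed action, gives 0 and 2 e_1 (e_6 x) respectively.\<close>

lemma neg_all_zero:
  assumes n1: "L 1 (L 2 x) = - L 3 x" and n2: "L 1 (L 4 x) = - L 5 x"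
    and n3: "L 1 (L 7 x) = - L 6 x" and n4: "L 2 (L 4 x) = - L 6 x"
  shows "x = 0"
proof -
  have n3': "L 1 (L 6 x) = L 7 x" "L 7 (L 6 x) = - L 1 x"
    using neg_rotate[OF qlines(3) n3] neg_rotate[OF qline_rotate[OF qlines(3)] neg_rotate[OF qlines(3) n3]]
    by (simp_all add: L_anticomm[of 1 6])
  \<comment> \<open>A unit on a line preserves the sign with which that line acts, so
    \<open>neg_rm_first\<close> applies to \<open>L 4 x\<close> on the line (1,4,5) and to
    \<open>L 6 x\<close> on the line (1,7,6).\<close>
  have R4: "rm (L 4 x) (oe 1) = - L 1 (L 4 x)"
  proof (rule neg_rm_first[OF qlines(2)])
    have "L 1 (L 4 (L 4 x)) = - L 1 x" by simp
    also have "L 1 x = L 5 (L 4 x)"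
      using neg_rotate[OF qlines(2) n2] by (simp add: L_anticomm[of 5 4])
    finally show "L 1 (L 4 (L 4 x)) = - L 5 (L 4 x)" .
  qed
  have R6: "rm (L 6 x) (oe 1) = - L 1 (L 6 x)"
  proof (rule neg_rm_first[OF qlines(3)])
    show "L 1 (L 7 (L 6 x)) = - L 6 (L 6 x)" by (simp add: n3')
  qed
  have "rm (L 2 (L 4 x)) (oe 1)
      = L 2 (rm (L 4 x) (oe 1)) + L 3 (L 4 x) - L 1 (L 2 (L 4 x))"
    by (simp add: assoc_middle[of "oe 2"] omult_table)
  moreover have "rm (L 2 (L 4 x)) (oe 1) = L 1 (L 6 x)" by (simp add: n4 R6)
  moreover have "L 2 (rm (L 4 x) (oe 1)) = - L 1 (L 6 x)"
    by (simp add: R4 L_anticomm[of 2 1] n4)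
  moreover have "L 3 (L 4 x) = L 1 (L 2 (L 4 x))"
  proof -
    have "L 3 (L 4 x) = - L 4 (L 3 x)" by (simp add: L_anticomm[of 3 4])
    also have "\<dots> = L 4 (L 1 (L 2 x))" by (simp add: n1)
    also have "\<dots> = L 1 (L 2 (L 4 x))" by (simp add: L_anticomm[of 4 1] L_anticomm[of 4 2])
    finally show ?thesis .
  qed
  ultimately have "2 *\<^sub>R L 1 (L 6 x) = 0" by (simp add: scaleR_2 eq_neg_iff_add_eq_0)
  then have "L 6 (L 1 (L 1 (L 6 x))) = 0" by simp
  then show ?thesis by simp
qed

text \<open>For a line (a,b,c) these are commuting involutions. On the octonions themselves h is 1 on the
  span of 1, e_a, e_b, e_c and -1 on its orthogonal complement.\<close>

definition h :: "8 \<Rightarrow> 8 \<Rightarrow> 8 \<Rightarrow> 'v \<Rightarrow> 'v" where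
  "h a b c x = - L c (L a (L b x))"

lemma h_lin [simp]:
  "h a b c (x + y) = h a b c x + h a b c y" "h a b c (- x) = - h a b c x"
  "h a b c (x - y) = h a b c x - h a b c y" "h a b c (r *\<^sub>R x) = r *\<^sub>R h a b c x"
  by (simp_all add: h_def)

text \<open>Count the signs when e_y passes the three factors of \<open>h\<close>: off the line all
  three anticommute with it; on the line one factor is e_y itself and only two signs occur.\<close>

lemma h_L:
  assumes "a \<noteq> 0" "b \<noteq> 0" "c \<noteq> 0" "a \<noteq> b" "b \<noteq> c" "a \<noteq> c" "y \<noteq> 0"
  shows "h a b c (L y x) = (if y = a \<or> y = b \<or> y = c then L y (h a b c x) else - L y (h a b c x))"
proof -
  consider "y = a" | "y = b" | "y = c" | "y \<noteq> a" "y \<noteq> b" "y \<noteq> c" by blast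
  then show ?thesis
  proof cases
    case 1
    with assms show ?thesis by (simp add: h_def L_anticomm[of b a] L_anticomm[of c a])
  next
    case 2
    with assms show ?thesis by (simp add: h_def L_anticomm[of a b] L_anticomm[of c b])
  next
    case 3
    with assms show ?thesis by (simp add: h_def L_anticomm[of a c] L_anticomm[of b c])
  next
    case 4
    with assms show ?thesis by (simp add: h_def L_anticomm[of a y] L_anticomm[of b y] L_anticomm[of c y])
  qed
qed

lemma h_sq:
  assumes "a \<noteq> 0" "b \<noteq> 0" "c \<noteq> 0" "a \<noteq> b" "b \<noteq> c" "a \<noteq> c"
  shows "h a b c (h a b c x) = x"
  using assms by (simp add: h_def L_anticomm[of a c] L_anticomm[of b c] L_anticomm[of b a])

text \<open>The three lines through 1 and one further line suffice: on vectors where these four act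
  with sign +1, the products along the other three lines follow, as shown in
  \<open>proj_nucleus\<close>.\<close>

abbreviation "h1 \<equiv> h 1 2 3"
abbreviation "h2 \<equiv> h 1 4 5"
abbreviation "h3 \<equiv> h 1 7 6"
abbreviation "h4 \<equiv> h 2 4 6"

text \<open>Two distinct Fano lines meet in exactly one point, so by \<open>h_L\<close> moving one
  involution past the three factors of the other costs two minus signs.\<close>

lemma h_comm:
  "h4 (h1 x) = h1 (h4 x)" "h4 (h2 x) = h2 (h4 x)" "h4 (h3 x) = h3 (h4 x)"
  "h3 (h1 x) = h1 (h3 x)" "h3 (h2 x) = h2 (h3 x)" "h2 (h1 x) = h1 (h2 x)"
proof -
  have 1: "h a b c (h d e f x) = h d e f (h a b c x)"
    if "h a b c (L f (L d (L e x))) = L f (L d (L e (h a b c x)))" for a b c d e f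
    using that by (simp add: h_def[of d e f])
  show "h4 (h1 x) = h1 (h4 x)" "h4 (h2 x) = h2 (h4 x)" "h4 (h3 x) = h3 (h4 x)"
    "h3 (h1 x) = h1 (h3 x)" "h3 (h2 x) = h2 (h3 x)" "h2 (h1 x) = h1 (h2 x)"
    by (rule 1, simp add: h_L)+
qed

text \<open>16 times the projection onto the joint eigenspace of the four involutions for the eigenvalue
  e = 1 or e = -1. The sixteen joint eigenspaces are the images of these two under the e_y.\<close>

definition proj :: "real \<Rightarrow> 'v \<Rightarrow> 'v" where
  "proj e x = (let x4 = x + e *\<^sub>R h4 x; x3 = x4 + e *\<^sub>R h3 x4; x2 = x3 + e *\<^sub>R h2 x3 in x2 + e *\<^sub>R h1 x2)"

text \<open>Each factor 1 + e h absorbs its own involution, since h (1 + e h) = e (1 + e h) when e^2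
  = 1 and h^2 = 1, and the factors commute.\<close>

lemma h_proj:
  assumes "e * e = 1"
  shows "h1 (proj e x) = e *\<^sub>R proj e x" "h2 (proj e x) = e *\<^sub>R proj e x"
    "h3 (proj e x) = e *\<^sub>R proj e x" "h4 (proj e x) = e *\<^sub>R proj e x"
  using assms by (simp_all add: proj_def Let_def h_comm h_sq algebra_simps)

lemma h_iff:
  assumes "a \<noteq> 0" "b \<noteq> 0" "c \<noteq> 0" "h a b c x = e *\<^sub>R x"
  shows "L a (L b x) = e *\<^sub>R L c x"
proof -
  have "L c (h a b c x) = L a (L b x)" using assms(1-3) by (simp add: h_def)
  then show ?thesis using assms(4) by simp
qed

text \<open>On the eigenspace for -1 all four lines act with the wrong sign, which
  \<open>neg_all_zero\<close> excludes in a bimodule.\<close>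

lemma proj_neg: "proj (-1) x = 0"
  using h_iff[of _ _ _ _ "-1", OF _ _ _ h_proj(1)[of "-1"]] h_iff[of _ _ _ _ "-1", OF _ _ _ h_proj(2)[of "-1"]]
    h_iff[of _ _ _ _ "-1", OF _ _ _ h_proj(3)[of "-1"]] h_iff[of _ _ _ _ "-1", OF _ _ _ h_proj(4)[of "-1"]]
  by (intro neg_all_zero) simp_all

text \<open>This is the resolution of the identity into the sixteen joint eigenspaces. The eight
  coming from the eigenvalue -1 vanish by \<open>proj_neg\<close>, the other eight are the
  conjugates of \<open>proj 1\<close> by the basis units.\<close>

lemma proj_sum:
  "16 *\<^sub>R x = proj 1 x - (\<Sum>i\<in>{1,2,3,4,5,6,7}. L i (proj 1 (L i x)))"
proof -
  \<comment> \<open>\<open>Q\<close> collects the words of even length in the four involutions;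
    adding the zero vector \<open>proj (-1) x\<close> to \<open>proj 1 x\<close> cancels the odd
    ones.\<close>
  define Q where "Q x = x + h1 (h2 x) + h1 (h3 x) + h1 (h4 x) + h2 (h3 x) + h2 (h4 x) + h3 (h4 x)
      + h1 (h2 (h3 (h4 x)))" for x
  have "proj 1 x = proj 1 x + proj (-1) x" for x by (simp add: proj_neg)
  then have proj: "proj 1 x = Q x + Q x" for x
    by (simp add: proj_def Let_def Q_def algebra_simps)
  \<comment> \<open>By \<open>h_L\<close>, conjugation by e_i multiplies each word by a sign. For
    every nontrivial even word the eight signs (i = 0 included) sum to zero, while the empty word is
    counted eight times.\<close>
  have "Q x - (\<Sum>i\<in>{1,2,3,4,5,6,7}. L i (Q (L i x))) = x + x + x + x + x + x + x + x"
    by (simp add: Q_def h_L algebra_simps)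
  also have "\<dots> = 8 *\<^sub>R x"
    by (simp add: scaleR_conv_sum)
  finally have "2 *\<^sub>R (Q x - (\<Sum>i\<in>{1,2,3,4,5,6,7}. L i (Q (L i x)))) = 16 *\<^sub>R x" by simp
  then show ?thesis unfolding proj scaleR_2 by (simp add: algebra_simps)
qed

section \<open>The nucleus as the real part of the bimodule\<close>

definition nucleus :: "'v set" where
  "nucleus = {m. \<forall>p q. lm p (lm q m) = lm (p \<cdot>\<^sub>O q) m}"

text \<open>One product with the right sign fixes the whole quaternion table of the line: rotation
  gives the cyclic products, anticommutation the reversed ones. The hypothesis is repeated so that
  the result is a complete set of rewrite rules.\<close>

lemma pos_line:
  assumes line: "qline a b c" and pos: "L a (L b m) = L c m"
  shows "L a (L b m) = L c m" "L b (L c m) = L a m" "L c (L a m) = L b m"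
    "L b (L a m) = - L c m" "L c (L b m) = - L a m" "L a (L c m) = - L b m"
proof -
  show 1: "L a (L b m) = L c m" by (rule pos)
  show 2: "L b (L c m) = L a m" by (rule pos_rotate[OF line 1])
  show 3: "L c (L a m) = L b m" by (rule pos_rotate[OF qline_rotate[OF line] 2])
  have nz: "a \<noteq> 0" "b \<noteq> 0" "c \<noteq> 0" "a \<noteq> b" "b \<noteq> c" "a \<noteq> c"
    using line by (auto simp: qline_def)
  show "L b (L a m) = - L c m" using L_anticomm[of b a m] nz 1 by simp
  show "L c (L b m) = - L a m" using L_anticomm[of c b m] nz 2 by simp
  show "L a (L c m) = - L b m" using L_anticomm[of a c m] nz 3 by simp
qed

lemma nucleus_basisI:
  assumes "\<And>i j. L i (L j m) = lm (oe i \<cdot>\<^sub>O oe j) m"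
  shows "m \<in> nucleus"
proof -
  have "L i (lm q m) = lm (oe i \<cdot>\<^sub>O q) m" for i q
    by (induction q rule: oct_basis_induct) (simp_all add: assms omult_lin)
  then have "lm p (lm q m) = lm (p \<cdot>\<^sub>O q) m" for p q
    by (induction p rule: oct_basis_induct) (simp_all add: omult_lin)
  then show ?thesis by (simp add: nucleus_def)
qed

text \<open>The four eigenvalue equations give four lines. Each remaining line is reached by
  replacing one unit by a product along a known line and anticommuting; then all products of basis
  units are available.\<close>

lemma proj_nucleus: "proj 1 x \<in> nucleus"
proof -
  define m where "m = proj 1 x"
  have hp: "h1 m = 1 *\<^sub>R m" "h2 m = 1 *\<^sub>R m" "h3 m = 1 *\<^sub>R m" "h4 m = 1 *\<^sub>R m"
    unfolding m_def by (rule h_proj; simp)+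
  have p1: "L 1 (L 2 m) = L 3 m" and p2: "L 1 (L 4 m) = L 5 m" and p3: "L 1 (L 7 m) = L 6 m"
    and p4: "L 2 (L 4 m) = L 6 m"
    using h_iff[OF _ _ _ hp(1)] h_iff[OF _ _ _ hp(2)] h_iff[OF _ _ _ hp(3)] h_iff[OF _ _ _ hp(4)]
    by simp_all
  note q1 = pos_line[OF qlines(1) p1] and q2 = pos_line[OF qlines(2) p2]
    and q3 = pos_line[OF qlines(3) p3] and q4 = pos_line[OF qlines(4) p4]
  have "L 2 (L 5 m) = L 2 (L 1 (L 4 m))" by (simp add: q2)
  also have "\<dots> = L 7 m" by (subst L_anticomm) (simp_all add: q4 q3)
  finally have "L 2 (L 5 m) = L 7 m" .
  note q5 = pos_line[OF qlines(5) this]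
  have "L 3 (L 4 m) = - L 4 (L 1 (L 2 m))" by (subst L_anticomm) (simp_all add: q1)
  also have "\<dots> = L 1 (L 4 (L 2 m))" by (subst L_anticomm) simp_all
  also have "\<dots> = L 7 m" by (simp add: q4 q3)
  finally have "L 3 (L 4 m) = L 7 m" .
  note q6 = pos_line[OF qlines(6) this]
  have "L 3 (L 6 m) = - L 6 (L 1 (L 2 m))" by (subst L_anticomm) (simp_all add: q1)
  also have "\<dots> = L 1 (L 6 (L 2 m))" by (subst L_anticomm) simp_all
  also have "\<dots> = L 5 m" by (simp add: q4 q2)
  finally have "L 3 (L 6 m) = L 5 m" .
  note q7 = pos_line[OF qlines(7) this]
  have "\<forall>i j. L i (L j m) = lm (oe i \<cdot>\<^sub>O oe j) m"
    unfolding forall_8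
    by (simp add: omult_table oone_mult q1 q2 q3 q4 q5 q6 q7 flip: oone_def)
  then show ?thesis unfolding m_def[symmetric] by (intro nucleus_basisI) blast
qed

text \<open>Both sides equal the associator of p, q and m r, and every imaginary unit is half an associator.\<close>

lemma nucleus_commutes_associator:
  assumes m: "m \<in> nucleus"
  shows "rm m ((r \<cdot>\<^sub>O p) \<cdot>\<^sub>O q - r \<cdot>\<^sub>O (p \<cdot>\<^sub>O q)) = lm ((r \<cdot>\<^sub>O p) \<cdot>\<^sub>O q - r \<cdot>\<^sub>O (p \<cdot>\<^sub>O q)) m"
proof -
  define D where "D = (\<lambda>p q x. lm (p \<cdot>\<^sub>O q) x - lm p (lm q x))"
  have ll: "lm p (lm q m) = lm (p \<cdot>\<^sub>O q) m" for p q
    using m by (simp add: nucleus_def)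
  have lr: "rm (lm q m) p = lm q (rm m p)" for p q
    by (simp add: assoc_middle ll)
  have rr: "rm (rm m p) q = rm m (p \<cdot>\<^sub>O q)" for p q
    by (simp add: assoc_right ll)
  have Dr: "D p q x = rm (rm x p) q - rm x (p \<cdot>\<^sub>O q)" for p q x
    by (simp add: D_def assoc_right)
  have Dm: "D p q x = rm (lm q x) p - lm q (rm x p)" for p q x
    by (simp add: D_def assoc_middle)
  have "rm m ((r \<cdot>\<^sub>O p) \<cdot>\<^sub>O q - r \<cdot>\<^sub>O (p \<cdot>\<^sub>O q)) = D p q (rm m r)"
    by (simp add: Dr rr)
  also have "\<dots> = D r p (lm q m)"
    by (subst Dm, subst Dr) (simp add: rr flip: lr)
  also have "\<dots> = lm ((r \<cdot>\<^sub>O p) \<cdot>\<^sub>O q - r \<cdot>\<^sub>O (p \<cdot>\<^sub>O q)) m"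
    by (simp add: D_def ll)
  finally show ?thesis .
qed

lemma nucleus_commutes:
  assumes m: "m \<in> nucleus"
  shows "rm m p = lm p m"
proof -
  have *: "rm m q = lm q m" if "(oe r \<cdot>\<^sub>O oe p) \<cdot>\<^sub>O oe s - oe r \<cdot>\<^sub>O (oe p \<cdot>\<^sub>O oe s) = 2 *\<^sub>R q" for r p s q
    using nucleus_commutes_associator[OF m, of "oe r" "oe p" "oe s"] that by simp
  have "\<forall>i. rm m (oe i) = L i m"
    unfolding forall_8
    \<comment> \<open>None of these triples is a line of the Fano plane, and each is ordered so that
      its associator is plus twice the unit in question.\<close>
    using *[of 2 5 6 "oe 1"] *[of 1 4 7 "oe 2"] *[of 1 6 4 "oe 3"] *[of 1 3 6 "oe 4"]
      *[of 1 2 6 "oe 5"] *[of 1 4 3 "oe 6"] *[of 1 2 4 "oe 7"]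
    by (simp add: omult_table omult_lin scaleR_2)
  then show ?thesis
    by (induction p rule: oct_basis_induct) simp_all
qed

lemma ReM_eq_nucleus: "ReM lm rm = nucleus"
  using nucleus_commutes by (auto simp: ReM_def nucleus_def assoc_pqx_def)

lemma nucleus_scaleR: "m \<in> nucleus \<Longrightarrow> c *\<^sub>R m \<in> nucleus"
  by (simp add: nucleus_def)

lemma nucleus_minus: "m \<in> nucleus \<Longrightarrow> - m \<in> nucleus"
  by (simp add: nucleus_def)

lemma zero_nucleus: "0 \<in> nucleus"
  by (simp add: nucleus_def)

section \<open>Decomposition over the basis and the bounded real part\<close>

lemma bimodule_decomposition:
  obtains xs where "\<And>i. xs i \<in> ReM lm rm" "x = (\<Sum>i\<in>UNIV. L i (xs i))"
proof
  define xs where "xs i = (if i = 0 then (1/16) *\<^sub>R proj 1 x else (1/16) *\<^sub>R (- proj 1 (L i x)))" for i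
  show "xs i \<in> ReM lm rm" for i
    by (simp add: ReM_eq_nucleus xs_def proj_nucleus nucleus_scaleR nucleus_minus del: scaleR_minus_right)
  have "x = (1/16) *\<^sub>R 16 *\<^sub>R x" by simp
  also have "\<dots> = (\<Sum>i\<in>UNIV. L i (xs i))"
    unfolding proj_sum by (simp add: sum_8 xs_def algebra_simps)
  finally show "x = (\<Sum>i\<in>UNIV. L i (xs i))" .
qed

text \<open>On the octonions, summing e_i x e_i over i > 0 multiplies 1 by -7 and each imaginary unit by 5.\<close>

definition re :: "'v \<Rightarrow> 'v" where
  "re x = (1/12) *\<^sub>R (5 *\<^sub>R x - (\<Sum>i\<in>{1,2,3,4,5,6,7}. rm (L i x) (oe i)))"

lemma re_linear: "linear re"
  by (rule linearI) (simp_all add: re_def algebra_simps)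

text \<open>On e_i m with m real both actions reduce to octonion products, so the formula takes its
  octonion values: (5 + 7)/12 = 1 for i = 0 and (5 - 5)/12 = 0 otherwise.\<close>

lemma re_decomposition:
  assumes xs: "\<And>i. xs i \<in> ReM lm rm"
  shows "re (\<Sum>i\<in>UNIV. L i (xs i)) = xs 0"
proof -
  have ll: "lm p (lm q (xs i)) = lm (p \<cdot>\<^sub>O q) (xs i)" for p q i
    using xs by (auto simp: ReM_eq_nucleus nucleus_def)
  have lr: "rm (lm p (xs i)) q = lm (p \<cdot>\<^sub>O q) (xs i)" for p q i
    using nucleus_commutes xs by (simp add: assoc_middle ll ReM_eq_nucleus)
  have nonreal: "re (L i (xs i)) = 0" if "i \<noteq> 0" for i
  proof -
    have "\<forall>i. i \<noteq> 0 \<longrightarrow> re (L i (xs i)) = 0"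
      unfolding forall_8 re_def by (simp add: ll lr omult_table omult_lin oone_mult scaleR_conv_sum)
    then show ?thesis using that by blast
  qed
  have real: "re (xs 0) = xs 0"
  proof -
    have "12 *\<^sub>R xs 0 = 5 *\<^sub>R xs 0 + 5 *\<^sub>R xs 0 + 2 *\<^sub>R xs 0"
      by (simp flip: scaleR_left_distrib)
    also have "\<dots> = 5 *\<^sub>R xs 0 - (\<Sum>i\<in>{1,2,3,4,5,6,7}. rm (L i (xs 0)) (oe i))"
      by (simp add: lr omult_table scaleR_conv_sum scaleR_2)
    finally have "12 *\<^sub>R re (xs 0) = 12 *\<^sub>R xs 0" unfolding re_def by simp
    then show ?thesis by simp
  qed
  have "re (\<Sum>i\<in>UNIV. L i (xs i)) = (\<Sum>i\<in>UNIV. re (L i (xs i)))"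
    by (rule linear_sum[OF re_linear])
  also have "\<dots> = xs 0" by (simp add: sum_8 nonreal real)
  finally show ?thesis .
qed

text \<open>A decomposition exists, and \<open>re\<close> reads off the component x_0 of any
  decomposition, so the definite description is well defined. The explicit formula also makes
  linearity and boundedness evident.\<close>

lemma ReV_eq_re: "ReV lm rm x = re x"
proof -
  obtain xs where xs: "\<And>i. xs i \<in> ReM lm rm" "x = (\<Sum>i\<in>UNIV. L i (xs i))"
    using bimodule_decomposition by blast
  show ?thesis
    unfolding ReV_def
  proof (rule the_equality)
    show "\<exists>xs. (\<forall>i. xs i \<in> ReM lm rm) \<and> x = (\<Sum>i\<in>UNIV. L i (xs i)) \<and> re x = xs 0"
      using xs re_decomposition[of xs, OF xs(1)] by (intro exI[of _ xs]) simp
  next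
    fix x0
    assume "\<exists>xs. (\<forall>i. xs i \<in> ReM lm rm) \<and> x = (\<Sum>i\<in>UNIV. L i (xs i)) \<and> x0 = xs 0"
    then obtain ys where "\<And>i. ys i \<in> ReM lm rm" "x = (\<Sum>i\<in>UNIV. L i (ys i))" "x0 = ys 0"
      by blast
    then show "x0 = re x" using re_decomposition[of ys] by simp
  qed
qed

text \<open>\<open>re\<close> fixes the real elements, so if it vanishes identically then so does
  every component in every decomposition.\<close>

lemma re_eq_0_imp_trivial:
  fixes x :: 'v
  assumes "\<And>x. re x = 0"
  shows "x = 0"
proof -
  obtain xs where xs: "\<And>i. xs i \<in> ReM lm rm" "x = (\<Sum>i\<in>UNIV. L i (xs i))"
    using bimodule_decomposition by blast
  have "m = 0" if m: "m \<in> ReM lm rm" for m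
  proof -
    have "re (\<Sum>i\<in>UNIV. L i (if i = 0 then m else 0)) = m"
      using re_decomposition[of "\<lambda>i. if i = 0 then m else 0"] m
      by (simp add: ReM_eq_nucleus zero_nucleus)
    then show ?thesis using assms by simp
  qed
  then have "xs i = 0" for i using xs(1) by blast
  then show ?thesis unfolding xs(2) by simp
qed

end

section \<open>Operators on a Banach space with a complex structure\<close>

lemma has_vector_derivative_iff_quotient:
  "(f has_vector_derivative d) (at x within A) \<longleftrightarrow>
     ((\<lambda>y. (f y - f x) /\<^sub>R (y - x)) \<longlongrightarrow> d) (at x within A)"
proof -
  have "norm (f y - f x - (y - x) *\<^sub>R d) / norm (y - x) = norm ((f y - f x) /\<^sub>R (y - x) - d)"
    if "y \<noteq> x" for y
  proof -
    have "(f y - f x) /\<^sub>R (y - x) - d = (f y - f x - (y - x) *\<^sub>R d) /\<^sub>R (y - x)"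
      using that by (simp only: scaleR_right_diff_distrib scaleR_scaleR) simp
    then show ?thesis by (simp add: divide_inverse mult.commute)
  qed
  then have "((\<lambda>y. norm (f y - f x - (y - x) *\<^sub>R d) / norm (y - x)) \<longlongrightarrow> 0) (at x within A) \<longleftrightarrow>
      ((\<lambda>y. norm ((f y - f x) /\<^sub>R (y - x) - d)) \<longlongrightarrow> 0) (at x within A)"
    by (intro tendsto_cong) (auto simp: eventually_at_filter)
  also have "\<dots> \<longleftrightarrow> ((\<lambda>y. (f y - f x) /\<^sub>R (y - x)) \<longlongrightarrow> d) (at x within A)"
    by (simp add: tendsto_norm_zero_iff LIM_zero_iff)
  finally show ?thesis
    by (simp add: has_vector_derivative_def has_derivative_iff_norm bounded_linear_scaleR_left)
qed

lemma bounded_linear_funpow: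
  fixes S :: "'v::real_normed_vector \<Rightarrow> 'v"
  shows "bounded_linear S \<Longrightarrow> bounded_linear (S ^^ n)"
  by (induction n) (auto simp: id_def o_def bounded_linear_ident intro: bounded_linear_compose)

text \<open>B y is the fixed point of x -> y + A x. Running the Banach fixed point theorem inside a
  closed invariant subspace K keeps the fixed point in K, which yields the invariance of K under
  B.\<close>

lemma id_minus_contraction_inverse:
  fixes A :: "'v::banach \<Rightarrow> 'v"
  assumes A: "bounded_linear A" and le: "\<And>x. norm (A x) \<le> c * norm x" and c: "0 \<le> c" "c < 1"
  obtains B where "bounded_linear B" "\<And>x. B (x - A x) = x" "\<And>x. B x - A (B x) = x"
    "\<And>K. closed K \<Longrightarrow> subspace K \<Longrightarrow> A ` K \<subseteq> K \<Longrightarrow> B ` K \<subseteq> K"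
proof -
  interpret A: bounded_linear A by fact
  have fix_ex: "\<exists>!x. x \<in> K \<and> y + A x = x"
    if K: "closed K" "subspace K" "A ` K \<subseteq> K" "y \<in> K" for K y
  proof (rule Banach_fix)
    show "complete K" using K(1) by (simp add: complete_eq_closed)
    show "K \<noteq> {}" using K(4) by blast
    show "(\<lambda>x. y + A x) ` K \<subseteq> K" using K by (auto intro: subspace_add)
    show "\<And>u v. u \<in> K \<Longrightarrow> v \<in> K \<Longrightarrow> dist (y + A u) (y + A v) \<le> c * dist u v"
      using le by (simp add: dist_norm flip: A.diff)
  qed (use c in auto)
  have ex: "\<exists>!x. y + A x = x" for y
    using fix_ex[of UNIV y] by simp
  define B where "B y = (THE x. y + A x = x)" for y
  have B: "y + A (B y) = B y" for y
    unfolding B_def by (rule theI'[OF ex])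
  have B_unique: "B y = x" if "y + A x = x" for x y
    using ex[of y] B[of y] that by blast
  show thesis
  proof
    show "bounded_linear B"
    proof (rule bounded_linear_intro)
      show "B (x + y) = B x + B y" for x y
        by (rule B_unique) (metis A.add B add.assoc add.left_commute)
      show "B (r *\<^sub>R x) = r *\<^sub>R B x" for r x
        by (rule B_unique) (metis A.scaleR B scaleR_right_distrib)
      show "norm (B y) \<le> norm y * (1 / (1 - c))" for y
      proof -
        have "norm (B y) \<le> norm y + c * norm (B y)"
          using norm_triangle_ineq[of y "A (B y)"] le[of "B y"] B[of y] by simp
        then show ?thesis using c by (simp add: field_simps)
      qed
    qed
    show "B (x - A x) = x" for x by (rule B_unique) simp
    show "B x - A (B x) = x" for x using B[of x] by (metis add_diff_cancel_right')
    show "B ` K \<subseteq> K" if K: "closed K" "subspace K" "A ` K \<subseteq> K" for K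
    proof
      fix z assume "z \<in> B ` K"
      then obtain y where y: "y \<in> K" "z = B y" by blast
      then obtain x where "x \<in> K" "y + A x = x" using fix_ex[OF K y(1)] by blast
      then show "z \<in> K" using B_unique y by simp
    qed
  qed
qed

section \<open>Complex scalars on a real Banach space\<close>

locale complex_banach =
  fixes j :: "'v::banach \<Rightarrow> 'v"
  assumes bounded_linear_j: "bounded_linear j"
    and j_j [simp]: "j (j x) = - x"
    and norm_cs': "norm (Re z *\<^sub>R x + Im z *\<^sub>R j x) = cmod z * norm x"
begin

sublocale j: bounded_linear j by (rule bounded_linear_j)

definition cs :: "complex \<Rightarrow> 'v \<Rightarrow> 'v" where
  "cs z x = Re z *\<^sub>R x + Im z *\<^sub>R j x"

lemma norm_cs [simp]: "norm (cs z x) = cmod z * norm x"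
  by (simp add: cs_def norm_cs')

lemma cs_cs [simp]: "cs z (cs w x) = cs (z * w) x"
  by (simp add: cs_def j.add j.scaleR algebra_simps)

lemma cs_1 [simp]: "cs 1 x = x" and cs_0 [simp]: "cs 0 x = 0" and cs_i: "cs \<i> x = j x"
  by (simp_all add: cs_def)

lemma cs_left: "cs (z + w) x = cs z x + cs w x" "cs (z - w) x = cs z x - cs w x"
    "cs (- z) x = - cs z x" "cs (r *\<^sub>R z) x = r *\<^sub>R cs z x"
  by (simp_all add: cs_def algebra_simps)

lemma bounded_linear_cs: "bounded_linear (cs z)"
  by (rule bounded_linear_intro[where K = "cmod z"])
    (simp_all add: cs_def j.add j.scaleR algebra_simps norm_cs')

lemmas cs_right = bounded_linear.linear[OF bounded_linear_cs, THEN linear_add]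
  bounded_linear.linear[OF bounded_linear_cs, THEN linear_diff]
  bounded_linear.linear[OF bounded_linear_cs, THEN linear_neg]
  bounded_linear.linear[OF bounded_linear_cs, THEN linear_scale]

lemma cs_j: "cs z (j x) = j (cs z x)"
  by (simp add: cs_def j.add j.scaleR)

lemma tendsto_cs [tendsto_intros]:
  assumes "(f \<longlongrightarrow> z) F" "(g \<longlongrightarrow> x) F"
  shows "((\<lambda>t. cs (f t) (g t)) \<longlongrightarrow> cs z x) F"
  unfolding cs_def by (intro tendsto_intros j.tendsto assms)

section \<open>Liftability through invariant subspaces\<close>

definition liftable :: "('v \<Rightarrow> 'w) \<Rightarrow> ('v \<Rightarrow> 'v) \<Rightarrow> bool" where
  "liftable \<phi> S \<longleftrightarrow> (\<forall>n x. \<phi> ((S ^^ n) (j x)) = \<phi> (j ((S ^^ n) x)))"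

text \<open>For an invariant K: f induces a complex-linear operator on the quotient by K.\<close>

definition linear_mod :: "'v set \<Rightarrow> ('v \<Rightarrow> 'v) \<Rightarrow> bool" where
  "linear_mod K f \<longleftrightarrow> bounded_linear f \<and> f ` K \<subseteq> K \<and> (\<forall>x. f (j x) - j (f x) \<in> K)"

definition csubspace :: "'v set \<Rightarrow> bool" where
  "csubspace K \<longleftrightarrow> closed K \<and> subspace K \<and> j ` K \<subseteq> K"

lemma linear_mod_comp:
  assumes K: "csubspace K" and f: "linear_mod K f" and g: "linear_mod K g"
  shows "linear_mod K (\<lambda>x. f (g x))"
proof -
  interpret f: bounded_linear f using f by (simp add: linear_mod_def)
  have "f (g (j x)) - j (f (g x)) \<in> K" for x
  proof -
    \<comment> \<open>The commutator of fg with j is f (gj - jg) + (fj - jf) g, and f preserves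
      K.\<close>
    have "f (g (j x) - j (g x)) \<in> K" "f (j (g x)) - j (f (g x)) \<in> K"
      using f g by (auto simp: linear_mod_def image_subset_iff)
    then have "f (g (j x) - j (g x)) + (f (j (g x)) - j (f (g x))) \<in> K"
      using K by (auto simp: csubspace_def intro: subspace_add)
    then show ?thesis by (simp add: f.diff)
  qed
  moreover have "bounded_linear (\<lambda>x. f (g x))"
    using f g by (intro bounded_linear_compose[of f g]) (simp_all add: linear_mod_def)
  ultimately show ?thesis using f g by (auto simp: linear_mod_def image_subset_iff)
qed

lemma linear_mod_diff:
  assumes K: "csubspace K" and f: "linear_mod K f" and g: "linear_mod K g"
  shows "linear_mod K (\<lambda>x. f x - g x)"
proof -
  have "f (j x) - g (j x) - j (f x - g x) \<in> K" for x
  proof -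
    have "(f (j x) - j (f x)) - (g (j x) - j (g x)) \<in> K"
      using f g K by (auto simp: linear_mod_def csubspace_def intro: subspace_diff)
    then show ?thesis by (simp add: j.diff algebra_simps)
  qed
  then show ?thesis using f g K
    by (auto simp: linear_mod_def csubspace_def image_subset_iff bounded_linear_sub intro: subspace_diff)
qed

lemma linear_mod_cs:
  assumes K: "csubspace K"
  shows "linear_mod K (cs z)"
proof -
  have "cs z x \<in> K" if "x \<in> K" for x
    using K that unfolding cs_def
    by (auto simp: csubspace_def intro!: subspace_add subspace_scale)
  then show ?thesis
    using K by (auto simp: linear_mod_def bounded_linear_cs cs_j csubspace_def subspace_0)
qed

lemma linear_mod_id: "csubspace K \<Longrightarrow> linear_mod K (\<lambda>x. x)"
proof -
  have "cs 1 = (\<lambda>x. x)" by (rule ext) simp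
  then show "csubspace K \<Longrightarrow> linear_mod K (\<lambda>x. x)"
    using linear_mod_cs[of K 1] by simp
qed

text \<open>Conjugating the commutator of f gives that of its inverse: gj - jg = g (jf - fj) g.
  Invariance of K under g is a separate assumption because f K could be smaller than K.\<close>

lemma linear_mod_inverse:
  assumes K: "csubspace K" and f: "linear_mod K f" and g: "bounded_linear g" "g ` K \<subseteq> K"
    and fg: "\<And>x. f (g x) = x" and gf: "\<And>x. g (f x) = x"
  shows "linear_mod K g"
proof -
  interpret g: bounded_linear g by (rule g(1))
  have "g (j x) - j (g x) \<in> K" for x
  proof -
    have "f (j (g x)) - j (f (g x)) \<in> K" using f by (simp add: linear_mod_def)
    then have "- (f (j (g x)) - j (f (g x))) \<in> K" using K unfolding csubspace_def by (blast intro: subspace_neg)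
    then have "g (j x - f (j (g x))) \<in> K" using g(2) fg by auto
    then show ?thesis by (simp add: g.diff gf)
  qed
  then show ?thesis using g by (simp add: linear_mod_def)
qed

lemma linear_mod_liftable:
  assumes K: "csubspace K" and S: "linear_mod K S" and \<phi>: "linear \<phi>" "\<And>x. x \<in> K \<Longrightarrow> \<phi> x = 0"
  shows "liftable \<phi> S"
proof -
  have "linear_mod K (S ^^ n)" for n
    by (induction n) (simp_all add: id_def o_def linear_mod_id K linear_mod_comp S)
  then have "\<phi> ((S ^^ n) (j x) - j ((S ^^ n) x)) = 0" for n x
    by (intro \<phi>(2)) (simp add: linear_mod_def)
  then show ?thesis by (simp add: liftable_def linear_diff[OF \<phi>(1)])
qed

text \<open>The condition on all powers of S is converted into one on a quotient, which, unlike the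
  former, is visibly stable under composition, differences and suitable inverses.\<close>

lemma liftable_linear_mod:
  assumes S: "bounded_linear S" "liftable \<phi> S" and \<phi>: "bounded_linear \<phi>"
  obtains K where "csubspace K" "linear_mod K S" "\<And>x. x \<in> K \<Longrightarrow> \<phi> x = 0"
proof
  interpret S: bounded_linear S by (rule S(1))
  interpret \<phi>: bounded_linear \<phi> by (rule \<phi>)
  have Sn: "bounded_linear (S ^^ n)" for n by (rule bounded_linear_funpow[OF S(1)])
  note Sn_lin = linear_add[OF bounded_linear.linear[OF Sn]] linear_diff[OF bounded_linear.linear[OF Sn]]
    linear_neg[OF bounded_linear.linear[OF Sn]] linear_scale[OF bounded_linear.linear[OF Sn]]
    linear_0[OF bounded_linear.linear[OF Sn]]
  have l: "\<phi> ((S ^^ n) (j x)) = \<phi> (j ((S ^^ n) x))" for n x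
    using S(2) by (simp add: liftable_def)
  have l': "\<phi> (j ((S ^^ n) (j x))) = - \<phi> ((S ^^ n) x)" for n x
    using l[of n "j x"] by (simp add: Sn_lin \<phi>.neg)
  have Suc_eq: "(S ^^ n) (S x) = (S ^^ Suc n) x" for n x by (simp add: funpow_swap1)
  \<comment> \<open>Testing both v and j v makes K stable under j. Liftability moves j across a
    power of S, which gives both the invariance under S and the membership of the
    commutators.\<close>
  define K where "K = {v. \<forall>n. \<phi> ((S ^^ n) v) = 0 \<and> \<phi> ((S ^^ n) (j v)) = 0}"
  have cont: "continuous_on UNIV (\<lambda>v. \<phi> ((S ^^ n) v))" "continuous_on UNIV (\<lambda>v. \<phi> ((S ^^ n) (j v)))" for n
    by (intro linear_continuous_on bounded_linear_compose[OF \<phi>] bounded_linear_compose[OF Sn] Sn bounded_linear_j)+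
  have "closed K"
    unfolding K_def by (intro closed_Collect_all closed_Collect_conj closed_Collect_eq cont continuous_on_const)
  moreover have "subspace K"
    unfolding K_def by (rule subspaceI) (simp_all add: Sn_lin \<phi>.add \<phi>.scaleR \<phi>.zero j.add j.scaleR j.zero)
  moreover have "j ` K \<subseteq> K"
    by (auto simp: K_def Sn_lin \<phi>.neg)
  ultimately show "csubspace K" by (simp add: csubspace_def)
  have "S ` K \<subseteq> K"
  proof
    fix w assume "w \<in> S ` K"
    then obtain v where v: "\<And>n. \<phi> ((S ^^ n) v) = 0" "\<And>n. \<phi> ((S ^^ n) (j v)) = 0" and w: "w = S v"
      unfolding K_def by blast
    have "\<phi> ((S ^^ n) (j w)) = 0" for n
      using v(2)[of "Suc n"] unfolding l Suc_eq w .
    moreover have "\<phi> ((S ^^ n) w) = 0" for n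
      unfolding w Suc_eq by (rule v(1))
    ultimately show "w \<in> K"
      using v(2) unfolding K_def by simp
  qed
  moreover have "S (j x) - j (S x) \<in> K" for x
    unfolding K_def mem_Collect_eq Sn_lin \<phi>.diff j.diff Suc_eq
    by (simp add: Sn_lin \<phi>.neg l l' Suc_eq del: funpow.simps)
  ultimately show "linear_mod K S" using S(1) by (simp add: linear_mod_def)
  show "\<phi> x = 0" if "x \<in> K" for x
    using that unfolding K_def by (metis (mono_tags, lifting) funpow_0 mem_Collect_eq)
qed

section \<open>The resolvent set: bound and openness\<close>

definition shift :: "('v \<Rightarrow> 'v) \<Rightarrow> complex \<Rightarrow> 'v \<Rightarrow> 'v" where
  "shift T z v = cs z v - T v"

definition resolvent_set :: "('v \<Rightarrow> 'w) \<Rightarrow> ('v \<Rightarrow> 'v) \<Rightarrow> complex set" where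
  "resolvent_set \<phi> T = {z. B_invertible (shift T z) \<and> liftable \<phi> (inv (shift T z))}"

lemma resolvent_setI:
  assumes T: "bounded_linear T" and S: "bounded_linear S" "\<And>x. S (shift T z x) = x" "\<And>x. shift T z (S x) = x"
    and lift: "liftable \<phi> S"
  shows "z \<in> resolvent_set \<phi> T"
proof -
  have "shift T z \<circ> S = id" "S \<circ> shift T z = id" using S by auto
  moreover from this have "inv (shift T z) = S" by (rule inv_unique_comp)
  moreover have "bounded_linear (shift T z)"
    using bounded_linear_sub[OF bounded_linear_cs T] by (simp add: shift_def[abs_def])
  ultimately show ?thesis using S lift by (auto simp: resolvent_set_def B_invertible_def)
qed

lemma resolvent_setE:
  assumes "z \<in> resolvent_set \<phi> T"
  obtains S where "S = inv (shift T z)" "bounded_linear S" "\<And>x. S (shift T z x) = x"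
    "\<And>x. shift T z (S x) = x" "liftable \<phi> S"
proof -
  obtain g where g: "bounded_linear g" "g \<circ> shift T z = id" "shift T z \<circ> g = id"
    using assms by (auto simp: resolvent_set_def B_invertible_def)
  then have "inv (shift T z) = g" by (intro inv_unique_comp)
  moreover from this have "liftable \<phi> g" using assms by (simp add: resolvent_set_def)
  ultimately show ?thesis using g by (intro that[of g]) (auto simp: fun_eq_iff)
qed

text \<open>Factor z - T as z (1 - A) with A = z^{-1} T, a contraction. The subspace K supplied by T
  is invariant under A, hence under the inverse of 1 - A. As T need not be complex linear, the
  scalar 1/z is applied before \<open>B\<close>.\<close>

lemma resolvent_set_large:
  assumes T: "bounded_linear T" "liftable \<phi> T" and \<phi>: "bounded_linear \<phi>" and z: "onorm T < cmod z"
  shows "z \<in> resolvent_set \<phi> T"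
proof -
  obtain K where K: "csubspace K" and TK: "linear_mod K T" and \<phi>K: "\<And>x. x \<in> K \<Longrightarrow> \<phi> x = 0"
    by (rule liftable_linear_mod[OF T \<phi>]) (rule that, assumption, assumption, blast)
  have z0: "0 < cmod z" using z onorm_pos_le[OF T(1)] by linarith
  then have [simp]: "z \<noteq> 0" by auto
  define A where "A = (\<lambda>x. cs (1 / z) (T x))"
  have AK: "linear_mod K A" unfolding A_def by (rule linear_mod_comp[OF K linear_mod_cs[OF K] TK])
  have A: "bounded_linear A" using AK by (simp add: linear_mod_def)
  have le: "norm (A x) \<le> onorm T / cmod z * norm x" for x
    using onorm[OF T(1), of x] z0 by (simp add: A_def norm_divide field_simps)
  have c: "0 \<le> onorm T / cmod z" "onorm T / cmod z < 1"
    using z z0 onorm_pos_le[OF T(1)] by simp_all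
  obtain B where B: "bounded_linear B" "\<And>x. B (x - A x) = x" "\<And>x. B x - A (B x) = x"
    "\<And>K. closed K \<Longrightarrow> subspace K \<Longrightarrow> A ` K \<subseteq> K \<Longrightarrow> B ` K \<subseteq> K"
    by (rule id_minus_contraction_inverse[OF A le c]) (rule that, assumption, blast+)
  have BK: "linear_mod K B"
  proof (rule linear_mod_inverse[OF K])
    show "linear_mod K (\<lambda>x. x - A x)" by (rule linear_mod_diff[OF K linear_mod_id[OF K] AK])
    show "B ` K \<subseteq> K" using B(4) K AK by (simp add: csubspace_def linear_mod_def)
  qed (simp_all add: B(1-3))
  have shift_eq: "shift T z x = cs z (x - A x)" for x
    by (simp add: shift_def A_def cs_right)
  define S where "S = (\<lambda>x. B (cs (1 / z) x))"
  have SK: "linear_mod K S" unfolding S_def by (rule linear_mod_comp[OF K BK linear_mod_cs[OF K]])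
  show ?thesis
  proof (rule resolvent_setI[OF T(1)])
    show "bounded_linear S" using SK by (simp add: linear_mod_def)
    show "liftable \<phi> S"
      by (rule linear_mod_liftable[OF K SK _ \<phi>K]) (simp_all add: \<phi> bounded_linear.linear)
  qed (simp_all add: shift_eq S_def B(2,3))
qed

text \<open>With S the inverse of z - T, factor w - T = (1 - A)(z - T), where A = (z - w) S is a
  contraction for w near z. Here K comes from the liftability of S, and the new inverse is S
  B.\<close>

lemma open_resolvent_set:
  assumes T: "bounded_linear T" and \<phi>: "bounded_linear \<phi>"
  shows "open (resolvent_set \<phi> T)"
  unfolding open_dist
proof
  fix z assume "z \<in> resolvent_set \<phi> T"
  then obtain S where "S = inv (shift T z)" and S: "bounded_linear S" "\<And>x. S (shift T z x) = x"
    "\<And>x. shift T z (S x) = x" "liftable \<phi> S"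
    by (rule resolvent_setE) (rule that, assumption, assumption, blast+)
  obtain K where K: "csubspace K" and SK: "linear_mod K S" and \<phi>K: "\<And>x. x \<in> K \<Longrightarrow> \<phi> x = 0"
    by (rule liftable_linear_mod[OF S(1,4) \<phi>]) (rule that, assumption, assumption, blast)
  obtain M where M: "0 < M" "\<And>x. norm (S x) \<le> norm x * M"
    using bounded_linear.pos_bounded[OF S(1)] by blast
  have "w \<in> resolvent_set \<phi> T" if w: "dist w z < 1 / M" for w
  proof -
    define A where "A = (\<lambda>x. cs (z - w) (S x))"
    have AK: "linear_mod K A" unfolding A_def by (rule linear_mod_comp[OF K linear_mod_cs[OF K] SK])
    have A: "bounded_linear A" using AK by (simp add: linear_mod_def)
    have le: "norm (A x) \<le> (dist w z * M) * norm x" for x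
      using mult_left_mono[OF M(2)[of x], of "cmod (z - w)"]
      by (simp add: A_def dist_norm norm_minus_commute algebra_simps)
    have c: "0 \<le> dist w z * M" "dist w z * M < 1"
      using w M(1) by (simp_all add: field_simps)
    obtain B where B: "bounded_linear B" "\<And>x. B (x - A x) = x" "\<And>x. B x - A (B x) = x"
      "\<And>K. closed K \<Longrightarrow> subspace K \<Longrightarrow> A ` K \<subseteq> K \<Longrightarrow> B ` K \<subseteq> K"
      by (rule id_minus_contraction_inverse[OF A le c]) (rule that, assumption, blast+)
    have BK: "linear_mod K B"
    proof (rule linear_mod_inverse[OF K])
      show "linear_mod K (\<lambda>x. x - A x)" by (rule linear_mod_diff[OF K linear_mod_id[OF K] AK])
      show "B ` K \<subseteq> K" using B(4) K AK by (simp add: csubspace_def linear_mod_def)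
    qed (simp_all add: B(1-3))
    have shift_eq: "shift T w x = shift T z x - A (shift T z x)" for x
      by (simp add: A_def S cs_left) (simp add: shift_def)
    define S' where "S' = (\<lambda>x. S (B x))"
    have SK': "linear_mod K S'" unfolding S'_def by (rule linear_mod_comp[OF K SK BK])
    show ?thesis
    proof (rule resolvent_setI[OF T(1)])
      show "bounded_linear S'" using SK' by (simp add: linear_mod_def)
      show "liftable \<phi> S'"
        by (rule linear_mod_liftable[OF K SK' _ \<phi>K]) (simp_all add: \<phi> bounded_linear.linear)
    qed (simp_all add: shift_eq S'_def B(2,3) S(2,3))
  qed
  then show "\<exists>e>0. \<forall>y. dist y z < e \<longrightarrow> y \<in> resolvent_set \<phi> T"
    using M(1) by (intro exI[of _ "1 / M"]) simp
qed

end

section \<open>An everywhere defined resolvent and its circle means\<close>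

context complex_banach
begin

context
  fixes T :: "'v \<Rightarrow> 'v" and S :: "complex \<Rightarrow> 'v \<Rightarrow> 'v"
  assumes T: "bounded_linear T" and S: "\<And>z. bounded_linear (S z)"
    and S_shift: "\<And>z x. S z (shift T z x) = x" and shift_S: "\<And>z x. shift T z (S z x) = x"
begin

text \<open>The scalar w - z stays between the two resolvents, because these are only real linear
  and need not commute with it.\<close>

lemma resolvent_identity: "S w x - S z x = - S z (cs (w - z) (S w x))"
proof -
  interpret Sz: bounded_linear "S z" by (rule S)
  have "S w x - S z x = S z (shift T z (S w x)) - S z (shift T w (S w x))"
    by (simp add: S_shift shift_S)
  also have "\<dots> = S z (- cs (w - z) (S w x))"
    by (simp add: shift_def cs_left flip: Sz.diff)
  finally show ?thesis by (simp add: Sz.neg)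
qed

text \<open>Joint continuity in the parameter and the vector: the resolvent identity first bounds
  the resolvents near z uniformly, then bounds their difference by a multiple of the
  distance.\<close>

lemma resolvent_tendsto:
  assumes f: "(f \<longlongrightarrow> z) F" and g: "(g \<longlongrightarrow> y) F"
  shows "((\<lambda>t. S (f t) (g t)) \<longlongrightarrow> S z y) F"
proof -
  interpret Sz: bounded_linear "S z" by (rule S)
  obtain M where M: "0 < M" "\<And>x. norm (S z x) \<le> norm x * M"
    using Sz.pos_bounded by blast
  \<comment> \<open>The radius 1/(2M) makes the perturbation term at most half of the norm of S w x,
    so that it can be absorbed on the left.\<close>
  have bound: "norm (S w x) \<le> 2 * M * norm x" if w: "dist w z < 1 / (2 * M)" for w x
  proof -
    have "S w x = S z x - S z (cs (w - z) (S w x))"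
      using resolvent_identity[of w x z] by (simp add: algebra_simps)
    then have "norm (S w x) \<le> norm (S z x) + norm (S z (cs (w - z) (S w x)))"
      by (metis norm_triangle_ineq4)
    also have "\<dots> \<le> norm x * M + norm (S w x) * (dist w z * M)"
      using M(2)[of x] M(2)[of "cs (w - z) (S w x)"] by (simp add: dist_norm algebra_simps)
    also have "norm (S w x) * (dist w z * M) \<le> norm (S w x) * (1 / 2)"
      using w M(1) by (intro mult_left_mono) (simp_all add: field_simps)
    finally have "norm (S w x) \<le> norm x * M + norm (S w x) * (1 / 2)" by simp
    moreover have "2 * M * norm x = 2 * (norm x * M)" by simp
    ultimately show ?thesis by linarith
  qed
  have close: "norm (S w x - S z y) \<le> dist w z * M * (2 * M * norm x) + norm (x - y) * M"
    if w: "dist w z < 1 / (2 * M)" for w x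
  proof -
    have "norm (S w x - S z y) \<le> norm (S w x - S z x) + norm (S z (x - y))"
      using norm_triangle_ineq[of "S w x - S z x" "S z x - S z y"] by (simp add: Sz.diff)
    moreover have "norm (S w x - S z x) \<le> dist w z * M * norm (S w x)"
      using M(2)[of "cs (w - z) (S w x)"] by (simp add: resolvent_identity dist_norm algebra_simps)
    moreover have "dist w z * M * norm (S w x) \<le> dist w z * M * (2 * M * norm x)"
      using bound[OF w] M(1) by (intro mult_left_mono) simp_all
    ultimately show ?thesis using M(2)[of "x - y"] by linarith
  qed
  have ev: "eventually (\<lambda>t. dist (f t) z < 1 / (2 * M)) F"
    using f M(1) by (intro tendstoD) simp_all
  have "((\<lambda>t. dist (f t) z * M * (2 * M * norm (g t)) + norm (g t - y) * M) \<longlongrightarrow>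
      0 * M * (2 * M * norm y) + norm (y - y) * M) F"
    using f by (intro tendsto_intros g) (simp add: tendsto_dist_iff[symmetric])
  then have lim: "((\<lambda>t. dist (f t) z * M * (2 * M * norm (g t)) + norm (g t - y) * M) \<longlongrightarrow> 0) F"
    by simp
  have "((\<lambda>t. S (f t) (g t) - S z y) \<longlongrightarrow> 0) F"
    by (rule Lim_null_comparison[OF _ lim]) (use ev close in \<open>auto elim: eventually_mono\<close>)
  then show ?thesis by (simp add: LIM_zero_iff)
qed

lemma resolvent_continuous_on:
  assumes "continuous_on A f" "continuous_on A g"
  shows "continuous_on A (\<lambda>t. S (f t) (g t))"
  using assms unfolding continuous_on_def by (blast intro: resolvent_tendsto)

lemma cs_continuous_on:
  assumes "continuous_on A f" "continuous_on A g"
  shows "continuous_on A (\<lambda>t. cs (f t) (g t))"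
  using assms unfolding continuous_on_def by (blast intro: tendsto_cs)

text \<open>By the resolvent identity the difference quotient is a product of two resolvents around
  the difference quotient of the path, and joint continuity gives the limit.\<close>

lemma resolvent_has_vector_derivative:
  assumes "(\<gamma> has_vector_derivative d) (at t within A)"
  shows "((\<lambda>t. S (\<gamma> t) x) has_vector_derivative - S (\<gamma> t) (cs d (S (\<gamma> t) x))) (at t within A)"
proof -
  interpret St: bounded_linear "S (\<gamma> t)" by (rule S)
  have quot: "((\<lambda>u. (\<gamma> u - \<gamma> t) /\<^sub>R (u - t)) \<longlongrightarrow> d) (at t within A)"
    using assms by (simp add: has_vector_derivative_iff_quotient)
  have "(\<gamma> \<longlongrightarrow> \<gamma> t) (at t within A)"
    using has_vector_derivative_continuous[OF assms] by (simp add: continuous_within)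
  then have "((\<lambda>u. - S (\<gamma> t) (cs ((\<gamma> u - \<gamma> t) /\<^sub>R (u - t)) (S (\<gamma> u) x))) \<longlongrightarrow>
      - S (\<gamma> t) (cs d (S (\<gamma> t) x))) (at t within A)"
    by (intro tendsto_intros St.tendsto resolvent_tendsto quot)
  moreover have "(S (\<gamma> u) x - S (\<gamma> t) x) /\<^sub>R (u - t) = - S (\<gamma> t) (cs ((\<gamma> u - \<gamma> t) /\<^sub>R (u - t)) (S (\<gamma> u) x))" for u
    by (simp add: resolvent_identity cs_left St.scaleR St.neg)
  ultimately show ?thesis by (simp add: has_vector_derivative_iff_quotient)
qed

lemma resolvent_norm_le: "(cmod z - onorm T) * norm (S z x) \<le> norm x"
proof -
  have "cmod z * norm (S z x) = norm (x + T (S z x))"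
    using shift_S[of z x] unfolding shift_def by (metis diff_add_cancel norm_cs)
  also have "\<dots> \<le> norm x + onorm T * norm (S z x)"
    using norm_triangle_ineq[of x "T (S z x)"] onorm[OF T, of "S z x"] by linarith
  finally show ?thesis by (simp add: algebra_simps)
qed

text \<open>With s = r e^{it}, liftability turns r times the r-derivative of the integrand into the
  t-derivative of a periodic function, so the integral over t does not depend on r.\<close>

lemma resolvent_circle_integral_zero:
  fixes \<phi> :: "'v \<Rightarrow> 'w::banach"
  assumes \<phi>: "bounded_linear \<phi>" and lift: "\<And>z y. \<phi> (S z (j y)) = \<phi> (j (S z y))"
  shows "\<phi> (S 0 x) = 0"
proof -
  interpret \<phi>: bounded_linear \<phi> by (rule \<phi>)
  define F where "F r t = \<phi> (S (of_real r * cis t) x)" for r t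
  define F' where "F' r t = - \<phi> (S (of_real r * cis t) (cs (cis t) (S (of_real r * cis t) x)))" for r t
  define M where "M r = integral {0..2*pi} (F r)" for r
  have cis_deriv: "(cis has_vector_derivative \<i> * cis t) (at t within A)" for t A
    
    using has_derivative_cis[OF has_derivative_ident] by (simp add: has_vector_derivative_def)
  have F_cont: "continuous_on {0..2*pi} (F r)" for r
    unfolding F_def[abs_def]
    by (rule \<phi>.continuous_on, rule resolvent_continuous_on) (intro continuous_intros)+
  have deriv: "(M has_vector_derivative integral {0..2*pi} (F' r)) (at r)" for r
  proof -
    have "((\<lambda>r. integral (cbox 0 (2*pi)) (F r)) has_vector_derivative integral (cbox 0 (2*pi)) (F' r)) (at r within UNIV)"
    proof (rule leibniz_rule_vector_derivative)
      fix r t :: real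
      have "((\<lambda>r. of_real r * cis t) has_vector_derivative cis t) (at r)"
        by (auto intro!: derivative_eq_intros simp: has_vector_derivative_def scaleR_conv_of_real)
      from \<phi>.has_vector_derivative[OF resolvent_has_vector_derivative[OF this]]
      show "((\<lambda>r. F r t) has_vector_derivative F' r t) (at r within UNIV)"
        by (simp add: F_def F'_def \<phi>.neg)
    next
      show "continuous_on (UNIV \<times> cbox 0 (2*pi)) (\<lambda>(r, t). F' r t)"
      proof -
        have 1: "continuous_on A (\<lambda>p. complex_of_real (fst p) * cis (snd p))"
          and 2: "continuous_on A (\<lambda>p. cis (snd p))" for A :: "(real \<times> real) set"
          by (intro continuous_intros)+
        have "continuous_on (UNIV \<times> cbox 0 (2*pi)) (\<lambda>p. - \<phi> (S (of_real (fst p) * cis (snd p))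
            (cs (cis (snd p)) (S (of_real (fst p) * cis (snd p)) x))))"
          by (rule continuous_on_minus, rule \<phi>.continuous_on, rule resolvent_continuous_on[OF 1],
              rule cs_continuous_on[OF 2], rule resolvent_continuous_on[OF 1], rule continuous_on_const)
        then show ?thesis by (simp add: F'_def split_beta)
      qed
    qed (auto intro!: integrable_continuous_real F_cont simp: box_real)
    then show ?thesis by (simp add: M_def[abs_def] box_real)
  qed
  \<comment> \<open>A primitive of r F' in t is minus \<open>\<phi>\<close> of j S(r e^{it}) x.
    Differentiating the path produces the factor i r e^{it}; liftability brings j inside S, where it
    turns i into -1. Equal values at 0 and 2 pi make the integral vanish.\<close>
  have "integral {0..2*pi} (F' r) = 0" if "r \<noteq> 0" for r
  proof -
    have "((\<lambda>t. r *\<^sub>R F' r t) has_integral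
        - \<phi> (j (S (of_real r * cis (2*pi)) x)) - - \<phi> (j (S (of_real r * cis 0) x))) {0..2*pi}"
    proof (rule fundamental_theorem_of_calculus)
      fix t :: real
      have "((\<lambda>t. of_real r * cis t) has_vector_derivative of_real r * (\<i> * cis t)) (at t within {0..2*pi})"
        by (intro has_vector_derivative_mult_right cis_deriv)
      note der = has_vector_derivative_minus[OF
          \<phi>.has_vector_derivative[OF j.has_vector_derivative[OF resolvent_has_vector_derivative[OF this]]]]
      show "((\<lambda>t. - \<phi> (j (S (of_real r * cis t) x))) has_vector_derivative r *\<^sub>R F' r t) (at t within {0..2*pi})"
      proof -
        have "\<phi> (j (S z (cs (of_real r * (\<i> * c)) y))) = - (r *\<^sub>R \<phi> (S z (cs c y)))" for z c y
        proof -
          interpret Sz: bounded_linear "S z" by (rule S)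
          have "j (cs (of_real r * (\<i> * c)) y) = cs (\<i> * (of_real r * (\<i> * c))) y"
            by (simp flip: cs_i)
          also have "\<i> * (of_real r * (\<i> * c)) = - (r *\<^sub>R c)"
            by (simp add: scaleR_conv_of_real algebra_simps)
          finally show ?thesis
            by (simp add: lift[symmetric] cs_left Sz.neg Sz.scaleR \<phi>.neg \<phi>.scaleR)
        qed
        with der show ?thesis
          by (simp add: F'_def j.neg \<phi>.neg)
      qed
    qed simp
    then have "((\<lambda>t. r *\<^sub>R F' r t) has_integral 0) {0..2*pi}" by simp
    then have "r *\<^sub>R integral {0..2*pi} (F' r) = 0"
      by (metis integral_unique integral_cmul)
    then show ?thesis using that by simp
  qed
  with deriv have deriv0: "(M has_vector_derivative 0) (at r)" if "r \<noteq> 0" for r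
    using that by (metis)
  \<comment> \<open>The factor r could be cancelled only for r nonzero; continuity of
    \<open>M\<close> takes care of the exceptional point 0.\<close>
  have M_const: "M r = M 0" if "0 < r" for r
  proof (rule has_derivative_zero_unique_strong_interval[where k = "{0}" and a = 0 and b = r])
    show "continuous_on {0..r} M"
      using deriv by (intro continuous_at_imp_continuous_on ballI has_vector_derivative_continuous)
    show "(M has_derivative (\<lambda>h. 0)) (at s within {0..r})" if "s \<in> {0..r} - {0}" for s
      using deriv0[of s] that by (auto simp: has_vector_derivative_def intro: has_derivative_at_withinI)
  qed (use that in auto)
  obtain C where C: "0 < C" "\<And>x. norm (\<phi> x) \<le> norm x * C"
    using \<phi>.pos_bounded by blast
  have M_bound: "(r - onorm T) * norm (M r) \<le> norm x * C * (2 * pi)" if r: "onorm T < r" for r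
  proof -
    have "norm (F r t) \<le> norm x * C / (r - onorm T)" for t
    proof -
      have "r > 0" using r onorm_pos_le[OF T] by linarith
      then have "(r - onorm T) * norm (S (of_real r * cis t) x) \<le> norm x"
        using resolvent_norm_le[of "of_real r * cis t" x] by (simp add: norm_mult)
      then have "norm (S (of_real r * cis t) x) \<le> norm x / (r - onorm T)"
        using r by (simp add: field_simps)
      then have "norm (S (of_real r * cis t) x) * C \<le> norm x / (r - onorm T) * C"
        using C(1) by (intro mult_right_mono) simp_all
      then show ?thesis
        using C(2)[of "S (of_real r * cis t) x"] unfolding F_def by simp
    qed
    then have "norm (M r) \<le> norm x * C / (r - onorm T) * (2 * pi - 0)"
      unfolding M_def by (intro integral_bound F_cont) simp_all
    then show ?thesis using r by (simp add: field_simps)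
  qed
  have "M 0 = 0"
  proof (rule ccontr)
    assume "M 0 \<noteq> 0"
    \<comment> \<open>This radius makes (r - onorm T) |M 0| exceed the bound from
      \<open>M_bound\<close> by exactly |M 0|.\<close>
    define r where "r = onorm T + 1 + norm x * C * (2 * pi) / norm (M 0)"
    have nonneg: "0 \<le> norm x * C * (2 * pi)" using C(1) by simp
    then have "0 \<le> norm x * C * (2 * pi) / norm (M 0)" by (rule divide_nonneg_nonneg) simp
    then have r: "onorm T < r" unfolding r_def by linarith
    then have "0 < r" using onorm_pos_le[OF T] by linarith
    have "(r - onorm T) * norm (M 0) \<le> norm x * C * (2 * pi)"
      using M_bound[OF r] M_const[OF \<open>0 < r\<close>] by simp
    moreover have "(r - onorm T) * norm (M 0) = norm (M 0) + norm x * C * (2 * pi)"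
      using \<open>M 0 \<noteq> 0\<close> by (simp add: r_def distrib_right)
    ultimately show False using \<open>M 0 \<noteq> 0\<close> by simp
  qed
  moreover have "M 0 = (2 * pi) *\<^sub>R \<phi> (S 0 x)"
    by (simp add: M_def F_def[abs_def])
  ultimately show ?thesis by simp
qed

end

lemma resolvent_set_not_UNIV:
  fixes \<phi> :: "'v \<Rightarrow> 'w::banach"
  assumes T: "bounded_linear T" and \<phi>: "bounded_linear \<phi>" "\<phi> v \<noteq> 0"
  shows "resolvent_set \<phi> T \<noteq> UNIV"
proof
  assume univ: "resolvent_set \<phi> T = UNIV"
  define S where "S z = inv (shift T z)" for z
  have S: "bounded_linear (S z)" "S z (shift T z x) = x" "shift T z (S z x) = x" "liftable \<phi> (S z)" for z x
    using resolvent_setE[of z \<phi> T] univ unfolding S_def by (metis UNIV_I)+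
  have "\<phi> (S z (j y)) = \<phi> (j (S z y))" for z y
    using S(4)[of z, unfolded liftable_def, rule_format, of 1 y] by simp
  \<comment> \<open>The vector \<open>shift T 0 v\<close> is chosen because S 0 maps it back to v,
    where \<open>\<phi>\<close> is nonzero.\<close>
  from resolvent_circle_integral_zero[OF T S(1-3) \<phi>(1) this, of "shift T 0 v"]
  show False using S(2) \<phi>(2) by simp
qed

end

section \<open>The push-forward spectrum\<close>

locale banach_octonion_bimodule = octonion_bimodule lm rm
  for lm :: "oct \<Rightarrow> 'v::banach \<Rightarrow> 'v" and rm :: "'v \<Rightarrow> oct \<Rightarrow> 'v" +
  assumes norm_lm: "norm (lm p x) = norm p * norm x"
    and norm_rm: "norm (rm x p) = norm p * norm x"
begin

lemma bounded_linear_lm: "bounded_linear (lm p)"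
  by (rule bounded_linear_intro[where K = "norm p"]) (simp_all add: norm_lm)

lemma bounded_linear_rm: "bounded_linear (\<lambda>x. rm x p)"
  by (rule bounded_linear_intro[where K = "norm p"]) (simp_all add: norm_rm)

lemma bounded_linear_re: "bounded_linear re"
  unfolding re_def[abs_def]
  by (intro bounded_linear_compose[OF bounded_linear_scaleR_right] bounded_linear_sub
      bounded_linear_sum bounded_linear_scaleR_right bounded_linear_compose[OF bounded_linear_rm bounded_linear_lm])

context
  fixes J :: oct
  assumes J: "J \<in> oct_S"
begin

interpretation cb: complex_banach "\<lambda>x. rm x J"
proof (rule complex_banach.intro)
  show "bounded_linear (\<lambda>x. rm x J)" by (rule bounded_linear_rm)
  show "rm (rm x J) J = - x" for x
    using J by (simp add: rm_alternative oct_S_def)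
  show "norm (Re z *\<^sub>R x + Im z *\<^sub>R rm x J) = cmod z * norm x" for z x
    using norm_rm[of x "Re z *\<^sub>R oone + Im z *\<^sub>R J"] by (simp add: norm_CJ[OF J] cmod_def)
qed

definition emb :: "complex \<Rightarrow> oct" where
  "emb z = Re z *\<^sub>R oone + Im z *\<^sub>R J"

lemma norm_emb: "norm (emb z) = cmod z"
  by (simp add: emb_def norm_CJ[OF J] cmod_def)

lemma rm_emb: "rm x (emb z) = cb.cs z x"
  by (simp add: emb_def cb.cs_def)

lemma CJ_eq_range_emb: "CJ J = range emb"
proof -
  have "a *\<^sub>R oone + b *\<^sub>R J = emb (Complex a b)" for a b by (simp add: emb_def)
  then show ?thesis unfolding CJ_def emb_def by blast
qed

lemma inj_emb: "inj emb"
proof (rule injI)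
  fix z w assume "emb z = emb w"
  then have "emb (z - w) = 0" by (simp add: emb_def algebra_simps)
  then show "z = w" using norm_emb[of "z - w"] by simp
qed

lemma continuous_emb: "continuous_on A emb"
  unfolding emb_def[abs_def] by (intro continuous_intros)

text \<open>J is itself in C_J, which gives one direction; real linearity extends the identity from
  1 and J to the whole slice. For n = 0 both sides agree trivially.\<close>

lemma liftable_iff:
  assumes S: "bounded_linear S"
  shows "CJ_liftable_power_assoc lm rm J S \<longleftrightarrow> cb.liftable re S"
proof
  assume l: "CJ_liftable_power_assoc lm rm J S"
  have "J \<in> CJ J" unfolding CJ_def by (rule CollectI, rule exI[of _ 0], rule exI[of _ 1]) simp
  then have "re ((S ^^ n) (rm x J)) = re (rm ((S ^^ n) x) J)" for n x
    using l by (cases n) (auto simp: CJ_liftable_power_assoc_def ReV_eq_re simp del: funpow.simps(2))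
  then show "cb.liftable re S" by (simp add: cb.liftable_def)
next
  assume l: "cb.liftable re S"
  interpret re: bounded_linear re by (rule bounded_linear_re)
  have "re ((S ^^ n) (rm x (emb z))) = re (rm ((S ^^ n) x) (emb z))" for n x z
  proof -
    interpret Sn: bounded_linear "S ^^ n" by (rule bounded_linear_funpow[OF S])
    show ?thesis
      using l by (simp add: emb_def cb.liftable_def Sn.add Sn.scaleR re.add re.scaleR)
  qed
  then show "CJ_liftable_power_assoc lm rm J S"
    by (auto simp: CJ_liftable_power_assoc_def ReV_eq_re CJ_eq_range_emb)
qed

text \<open>Right multiplication by \<open>emb z\<close> is the complex scalar z, so R_s - T becomes
  \<open>shift T z\<close> and the results on the complex plane carry over to C_J.\<close>

lemma rho_J_eq:
  shows "rho_J lm rm J T = emb ` cb.resolvent_set re T"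
proof -
  have "emb z \<in> rho_J lm rm J T \<longleftrightarrow> z \<in> cb.resolvent_set re T" for z
  proof -
    have shift: "(\<lambda>v. rm v (emb z) - T v) = cb.shift T z"
      by (simp add: fun_eq_iff cb.shift_def rm_emb)
    have "bounded_linear (inv (cb.shift T z))" if "B_invertible (cb.shift T z)"
      using that inv_unique_comp unfolding B_invertible_def by metis
    then show ?thesis
      unfolding rho_J_def cb.resolvent_set_def using liftable_iff
      by (auto simp: shift CJ_eq_range_emb)
  qed
  moreover have "rho_J lm rm J T \<subseteq> range emb" by (auto simp: rho_J_def CJ_eq_range_emb)
  ultimately show ?thesis by blast
qed

lemma power_associative_liftable:
  assumes "power_associative lm rm T"
  shows "cb.liftable re T"
proof -
  interpret re: bounded_linear re by (rule bounded_linear_re)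
  have "re (rm ((T ^^ n) x) J - (T ^^ n) (rm x J)) = 0" for n x
    using assms by (auto simp: power_associative_def B_RO_def ReV_eq_re)
  then show ?thesis by (simp add: cb.liftable_def re.diff)
qed

lemma large_in_rho_J:
  assumes T: "bounded_linear T" "power_associative lm rm T" and s: "s \<in> CJ J" "onorm T < norm s"
  shows "s \<in> rho_J lm rm J T"
proof -
  obtain z where z: "s = emb z" using s(1) CJ_eq_range_emb by blast
  have "z \<in> cb.resolvent_set re T"
    using cb.resolvent_set_large[OF T(1) power_associative_liftable[OF T(2)] bounded_linear_re] s(2)
    by (simp add: z norm_emb)
  then show ?thesis by (simp add: rho_J_eq z)
qed

lemma sigma_J_nonempty_compact:
  assumes T: "bounded_linear T" "power_associative lm rm T" and nontrivial: "(v :: 'v) \<noteq> 0"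
  shows "sigma_J lm rm J T \<noteq> {}" "compact (sigma_J lm rm J T)"
proof -
  define R where "R = cb.resolvent_set re T"
  have sigma: "sigma_J lm rm J T = emb ` (- R)"
    unfolding sigma_J_def CJ_eq_range_emb rho_J_eq R_def
    by (simp add: image_set_diff[OF inj_emb, symmetric] Compl_eq_Diff_UNIV)
  obtain x where "re x \<noteq> 0" using re_eq_0_imp_trivial nontrivial by blast
  then have "R \<noteq> UNIV"
    unfolding R_def by (rule cb.resolvent_set_not_UNIV[OF T(1) bounded_linear_re])
  then show "sigma_J lm rm J T \<noteq> {}" by (auto simp: sigma)
  have "closed (- R)"
    unfolding R_def by (intro closed_Compl cb.open_resolvent_set T(1) bounded_linear_re)
  moreover have "- R \<subseteq> cball 0 (onorm T)"
    using cb.resolvent_set_large[OF T(1) power_associative_liftable[OF T(2)] bounded_linear_re]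
    by (auto simp: R_def not_less[symmetric])
  \<comment> \<open>Compactness is proved in the complex plane and carried to C_J by the continuous
    map \<open>emb\<close>.\<close>
  ultimately have "compact (- R)"
    using bounded_subset[OF bounded_cball] by (simp add: compact_eq_bounded_closed)
  then show "compact (sigma_J lm rm J T)"
    unfolding sigma by (rule compact_continuous_image[OF continuous_emb])
qed

end

end

theorem mainTheorem11:
  fixes lm :: "oct \<Rightarrow> 'v::banach \<Rightarrow> 'v" and rm :: "'v \<Rightarrow> oct \<Rightarrow> 'v" and T :: "'v \<Rightarrow> 'v"
  assumes "Banach_O_bimodule lm rm"
    and "\<exists>v::'v. v \<noteq> 0"
    and "T \<in> B_RO lm rm"
    and "power_associative lm rm T"
  shows "(\<forall>s. norm s > onorm T \<longrightarrow>
            s \<in> rho_star lm rm T \<and> (\<forall>J\<in>oct_S. s \<in> CJ J \<longrightarrow> s \<in> rho_J lm rm J T))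
       \<and> (\<forall>J\<in>oct_S. sigma_J lm rm J T \<noteq> {} \<and> compact (sigma_J lm rm J T))"
proof -
  interpret banach_octonion_bimodule lm rm
    using assms(1) by unfold_locales (simp_all add: Banach_O_bimodule_def)
  have T: "bounded_linear T" using assms(3) by (simp add: B_RO_def)
  obtain v :: 'v where "v \<noteq> 0" using assms(2) by blast
  note large = large_in_rho_J[OF _ T assms(4)]
  \<comment> \<open>Every octonion lies in some slice by \<open>oct_in_some_CJ\<close>, so the bound
    for a fixed J applies.\<close>
  have "s \<in> rho_star lm rm T" if "norm s > onorm T" for s
    using oct_in_some_CJ[of s] large that by (auto simp: rho_star_def)
  then show ?thesis
    using large sigma_J_nonempty_compact[OF _ T assms(4) \<open>v \<noteq> 0\<close>] by blast
qed

end
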